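(* Let $(g,J)$ be a left invariant almost anti-Hermitian structure on a Lie group $G$ with Lie algebra $\mathfrak{g}$, let $\langle\cdot,\cdot\rangle$ be the inner product on $\mathfrak{g}$ induced by $g$, let $\nabla$ be the Levi-Civita connection of $g$, and let $\theta$ be the covariant $3$-tensor on $\mathfrak{g}$ given by $$\theta(X,Y,Z)=\langle D(X,Y),Z\rangle+\langle D(Y,Z),X\rangle+\langle D(Z,X),Y\rangle,\qquad D(X,Y)=\nabla_{JX}Y+J\nabla_XY .$$ Then $(G,g,J)$ is an anti-Kähler manifold (i.e. $\nabla J=0$) if and only if $\theta$ is skew-symmetric and pure on $\mathfrak{g}$; equivalently, if and only if $$\theta(X,Y,Z)=-\theta(X,Z,Y)\quad\text{and}\quad \theta(JX,Y,Z)=\theta(X,JY,Z)$$ for all $X,Y,Z\in\mathfrak{g}$.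
   Context: The Lie algebra $\mathfrak{g}$ of $G$ is the space of left invariant vector fields on $G$. A left invariant almost anti-Hermitian structure on $G$ is a pair $(g,J)$ where $g$ is a left invariant pseudo-Riemannian metric on $G$, $J$ is a left invariant almost complex structure on $G$ (so $J$ maps $\mathfrak{g}$ to $\mathfrak{g}$ and $J^2=-\mathrm{Id}$), and $g(JX,JY)=-g(X,Y)$ for all $X,Y$. Inner products are nondegenerate symmetric bilinear forms, not necessarily definite; $\langle X,Y\rangle=g(X,Y)$ for $X,Y\in\mathfrak{g}$ (a constant function). The Levi-Civita connection of a left invariant metric satisfies $\nabla_XY\in\mathfrak{g}$ for $X,Y\in\mathfrak{g}$. A covariant $3$-tensor $\theta$ on $\mathfrak{g}$ is pure (with respect to $J$) if $\theta(JX,Y,Z)=\theta(X,JY,Z)=\theta(X,Y,JZ)$ for all $X,Y,Z\in\mathfrak{g}$. *)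

theory Defs
  imports "HOL-Analysis.Analysis"
begin

section \<open>Smooth maps between Euclidean spaces\<close>

text \<open>
  Intended for open sets: all Frechet derivatives below are two-sided.  In finite dimension a
  function is of class C^(k+1) iff it is differentiable and all its directional derivatives
  are of class C^k.
\<close>

primrec C_diff_on ::
  "nat \<Rightarrow> ('e::real_normed_vector \<Rightarrow> 'f::real_normed_vector) \<Rightarrow> 'e set \<Rightarrow> bool" where
  "C_diff_on 0 f S \<longleftrightarrow> continuous_on S f"
| "C_diff_on (Suc k) f S \<longleftrightarrow>
     (\<forall>x\<in>S. f differentiable (at x)) \<and>
     (\<forall>v. C_diff_on k (\<lambda>x. frechet_derivative f (at x) v) S)"

definition smooth_on :: "'e set \<Rightarrow> ('e::real_normed_vector \<Rightarrow> 'f::real_normed_vector) \<Rightarrow> bool" where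
  "smooth_on S f \<longleftrightarrow> (\<forall>k. C_diff_on k f S)"


section \<open>Smooth manifolds\<close>

text \<open>
  A manifold is a type \<open>'a\<close>, with its topology, together with an atlas of charts into
  a Euclidean space \<open>'e\<close>.  A chart is a pair of its domain and its coordinate map.
  Atlases need not be maximal.
\<close>

type_synonym ('a, 'e) chart = "'a set \<times> ('a \<Rightarrow> 'e)"

abbreviation chart_dom :: "('a, 'e) chart \<Rightarrow> 'a set" where
  "chart_dom c \<equiv> fst c"

abbreviation chart_map :: "('a, 'e) chart \<Rightarrow> 'a \<Rightarrow> 'e" where
  "chart_map c \<equiv> snd c"

definition chart_inv :: "('a, 'e) chart \<Rightarrow> 'e \<Rightarrow> 'a" where
  "chart_inv c = inv_into (chart_dom c) (chart_map c)"

definition is_chart :: "('a::topological_space, 'e::topological_space) chart \<Rightarrow> bool" where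
  "is_chart c \<longleftrightarrow>
     open (chart_dom c) \<and> open (chart_map c ` chart_dom c) \<and>
     homeomorphism (chart_dom c) (chart_map c ` chart_dom c) (chart_map c) (chart_inv c)"

definition smooth_atlas ::
  "('a::{t2_space,second_countable_topology}, 'e::euclidean_space) chart set \<Rightarrow> bool" where
  "smooth_atlas A \<longleftrightarrow>
     (\<forall>c\<in>A. is_chart c) \<and> (\<Union>c\<in>A. chart_dom c) = UNIV \<and>
     (\<forall>c\<in>A. \<forall>d\<in>A. smooth_on (chart_map c ` (chart_dom c \<inter> chart_dom d))
                              (chart_map d \<circ> chart_inv c))"

definition prod_atlas ::
  "('a, 'e) chart set \<Rightarrow> ('b, 'f) chart set \<Rightarrow> ('a \<times> 'b, 'e \<times> 'f) chart set" where
  "prod_atlas A B =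
     {(chart_dom c \<times> chart_dom d, map_prod (chart_map c) (chart_map d)) | c d. c \<in> A \<and> d \<in> B}"

definition smooth_map ::
  "('a::topological_space, 'e::real_normed_vector) chart set \<Rightarrow>
   ('b::topological_space, 'f::real_normed_vector) chart set \<Rightarrow> ('a \<Rightarrow> 'b) \<Rightarrow> bool" where
  "smooth_map A B F \<longleftrightarrow>
     continuous_on UNIV F \<and>
     (\<forall>c\<in>A. \<forall>d\<in>B. smooth_on (chart_map c ` (chart_dom c \<inter> F -` chart_dom d))
                              (chart_map d \<circ> F \<circ> chart_inv c))"

text \<open>Real-valued functions smooth on an open subset \<open>U\<close> of the manifold.\<close>

definition smooth_fun ::
  "('a, 'e::real_normed_vector) chart set \<Rightarrow> 'a set \<Rightarrow> ('a \<Rightarrow> real) \<Rightarrow> bool" where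
  "smooth_fun A U f \<longleftrightarrow>
     (\<forall>c\<in>A. smooth_on (chart_map c ` (chart_dom c \<inter> U)) (f \<circ> chart_inv c))"


section \<open>Tangent vectors and vector fields\<close>

text \<open>
  The tangent space at \<open>p\<close> is identified with the model space \<open>'e\<close> by means of the chart
  \<open>chart_at A p\<close>, chosen once and for all for each point: an element of \<open>'e\<close> is the
  coordinate vector of a tangent vector at \<open>p\<close> with respect to that chart.  The chosen chart
  may jump from point to point, so smoothness of a vector field \<open>X :: 'a \<Rightarrow> 'e\<close> is not
  smoothness of \<open>X\<close> as an \<open>'e\<close>-valued function; it is defined through the coordinate
  representations of \<open>X\<close> in the charts of the atlas.
\<close>

definition chart_at :: "('a, 'e) chart set \<Rightarrow> 'a \<Rightarrow> ('a, 'e) chart" where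
  "chart_at A p = (SOME c. c \<in> A \<and> p \<in> chart_dom c)"

definition tangent_map ::
  "('a, 'e::real_normed_vector) chart set \<Rightarrow> ('b, 'f::real_normed_vector) chart set \<Rightarrow>
   ('a \<Rightarrow> 'b) \<Rightarrow> 'a \<Rightarrow> 'e \<Rightarrow> 'f" where
  "tangent_map A B F p v =
     frechet_derivative (chart_map (chart_at B (F p)) \<circ> F \<circ> chart_inv (chart_at A p))
       (at (chart_map (chart_at A p) p)) v"

text \<open>The components in the chart \<open>c\<close> of the vector \<open>X p\<close>, as a function of the coordinates
  of \<open>p\<close>.\<close>

definition vf_coords ::
  "('a, 'e::real_normed_vector) chart set \<Rightarrow> ('a, 'e) chart \<Rightarrow> ('a \<Rightarrow> 'e) \<Rightarrow> 'e \<Rightarrow> 'e" where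
  "vf_coords A c X x =
     (let p = chart_inv c x in
      frechet_derivative (chart_map c \<circ> chart_inv (chart_at A p))
        (at (chart_map (chart_at A p) p)) (X p))"

definition vector_fields ::
  "('a, 'e::real_normed_vector) chart set \<Rightarrow> ('a \<Rightarrow> 'e) set" where
  "vector_fields A = {X. \<forall>c\<in>A. smooth_on (chart_map c ` chart_dom c) (vf_coords A c X)}"

text \<open>The function \<open>X f\<close>, the derivative of \<open>f\<close> along \<open>X\<close>.\<close>

definition vf_apply ::
  "('a, 'e::real_normed_vector) chart set \<Rightarrow> ('a \<Rightarrow> 'e) \<Rightarrow> ('a \<Rightarrow> real) \<Rightarrow> 'a \<Rightarrow> real" where
  "vf_apply A X f p =
     frechet_derivative (f \<circ> chart_inv (chart_at A p)) (at (chart_map (chart_at A p) p)) (X p)"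

definition endo_apply :: "('a \<Rightarrow> 'e \<Rightarrow> 'e) \<Rightarrow> ('a \<Rightarrow> 'e) \<Rightarrow> 'a \<Rightarrow> 'e" where
  "endo_apply J X = (\<lambda>p. J p (X p))"


section \<open>Almost anti-Hermitian structures and connections\<close>

definition pseudo_riemannian_metric ::
  "('a, 'e::real_normed_vector) chart set \<Rightarrow> ('a \<Rightarrow> 'e \<Rightarrow> 'e \<Rightarrow> real) \<Rightarrow> bool" where
  "pseudo_riemannian_metric A g \<longleftrightarrow>
     (\<forall>p. bilinear (g p)) \<and>
     (\<forall>p v w. g p v w = g p w v) \<and>
     (\<forall>p v. (\<forall>w. g p v w = 0) \<longrightarrow> v = 0) \<and>
     (\<forall>X\<in>vector_fields A. \<forall>Y\<in>vector_fields A. smooth_fun A UNIV (\<lambda>p. g p (X p) (Y p)))"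

definition almost_complex_structure ::
  "('a, 'e::real_normed_vector) chart set \<Rightarrow> ('a \<Rightarrow> 'e \<Rightarrow> 'e) \<Rightarrow> bool" where
  "almost_complex_structure A J \<longleftrightarrow>
     (\<forall>p. linear (J p)) \<and>
     (\<forall>p v. J p (J p v) = - v) \<and>
     (\<forall>X\<in>vector_fields A. endo_apply J X \<in> vector_fields A)"

definition almost_anti_hermitian ::
  "('a, 'e::real_normed_vector) chart set \<Rightarrow> ('a \<Rightarrow> 'e \<Rightarrow> 'e \<Rightarrow> real) \<Rightarrow> ('a \<Rightarrow> 'e \<Rightarrow> 'e) \<Rightarrow> bool" where
  "almost_anti_hermitian A g J \<longleftrightarrow>
     pseudo_riemannian_metric A g \<and> almost_complex_structure A J \<and>
     (\<forall>p v w. g p (J p v) (J p w) = - g p v w)"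

definition affine_connection ::
  "('a, 'e::real_normed_vector) chart set \<Rightarrow> (('a \<Rightarrow> 'e) \<Rightarrow> ('a \<Rightarrow> 'e) \<Rightarrow> 'a \<Rightarrow> 'e) \<Rightarrow> bool" where
  "affine_connection A nabla \<longleftrightarrow>
     (\<forall>X\<in>vector_fields A. \<forall>Y\<in>vector_fields A. nabla X Y \<in> vector_fields A) \<and>
     (\<forall>X\<in>vector_fields A. \<forall>X'\<in>vector_fields A. \<forall>Y\<in>vector_fields A.
        nabla (\<lambda>p. X p + X' p) Y = (\<lambda>p. nabla X Y p + nabla X' Y p)) \<and>
     (\<forall>X\<in>vector_fields A. \<forall>Y\<in>vector_fields A. \<forall>Y'\<in>vector_fields A.
        nabla X (\<lambda>p. Y p + Y' p) = (\<lambda>p. nabla X Y p + nabla X Y' p)) \<and>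
     (\<forall>X\<in>vector_fields A. \<forall>Y\<in>vector_fields A. \<forall>f. smooth_fun A UNIV f \<longrightarrow>
        nabla (\<lambda>p. f p *\<^sub>R X p) Y = (\<lambda>p. f p *\<^sub>R nabla X Y p) \<and>
        nabla X (\<lambda>p. f p *\<^sub>R Y p) = (\<lambda>p. vf_apply A X f p *\<^sub>R Y p + f p *\<^sub>R nabla X Y p))"

text \<open>
  The bracket of \<open>X\<close> and \<open>Y\<close> is the vector field \<open>Z\<close> with \<open>Z f = X (Y f) - Y (X f)\<close> for all
  local smooth functions \<open>f\<close>; vanishing torsion says that this vector field is
  \<open>nabla X Y - nabla Y X\<close>.
\<close>

definition is_lie_bracket ::
  "('a::topological_space, 'e::real_normed_vector) chart set \<Rightarrow>
   ('a \<Rightarrow> 'e) \<Rightarrow> ('a \<Rightarrow> 'e) \<Rightarrow> ('a \<Rightarrow> 'e) \<Rightarrow> bool" where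
  "is_lie_bracket A X Y Z \<longleftrightarrow>
     Z \<in> vector_fields A \<and>
     (\<forall>U f. open U \<and> smooth_fun A U f \<longrightarrow>
       (\<forall>p\<in>U. vf_apply A Z f p =
               vf_apply A X (vf_apply A Y f) p - vf_apply A Y (vf_apply A X f) p))"

definition levi_civita_connection ::
  "('a::topological_space, 'e::real_normed_vector) chart set \<Rightarrow> ('a \<Rightarrow> 'e \<Rightarrow> 'e \<Rightarrow> real) \<Rightarrow>
   (('a \<Rightarrow> 'e) \<Rightarrow> ('a \<Rightarrow> 'e) \<Rightarrow> 'a \<Rightarrow> 'e) \<Rightarrow> bool" where
  "levi_civita_connection A g nabla \<longleftrightarrow>
     affine_connection A nabla \<and>
     (\<forall>X\<in>vector_fields A. \<forall>Y\<in>vector_fields A.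
        is_lie_bracket A X Y (\<lambda>p. nabla X Y p - nabla Y X p)) \<and>
     (\<forall>X\<in>vector_fields A. \<forall>Y\<in>vector_fields A. \<forall>Z\<in>vector_fields A. \<forall>p.
        vf_apply A X (\<lambda>q. g q (Y q) (Z q)) p = g p (nabla X Y p) (Z p) + g p (Y p) (nabla X Z p))"

definition cov_deriv_endo ::
  "(('a \<Rightarrow> 'e) \<Rightarrow> ('a \<Rightarrow> 'e) \<Rightarrow> 'a \<Rightarrow> 'e::real_vector) \<Rightarrow> ('a \<Rightarrow> 'e \<Rightarrow> 'e) \<Rightarrow>
   ('a \<Rightarrow> 'e) \<Rightarrow> ('a \<Rightarrow> 'e) \<Rightarrow> 'a \<Rightarrow> 'e" where
  "cov_deriv_endo nabla J X Y =
     (\<lambda>p. nabla X (endo_apply J Y) p - endo_apply J (nabla X Y) p)"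

text \<open>\<open>nabla\<close> is meant to be the Levi-Civita connection of \<open>g\<close>.\<close>

definition anti_kaehler ::
  "('a, 'e::real_normed_vector) chart set \<Rightarrow> ('a \<Rightarrow> 'e \<Rightarrow> 'e \<Rightarrow> real) \<Rightarrow> ('a \<Rightarrow> 'e \<Rightarrow> 'e) \<Rightarrow>
   (('a \<Rightarrow> 'e) \<Rightarrow> ('a \<Rightarrow> 'e) \<Rightarrow> 'a \<Rightarrow> 'e) \<Rightarrow> bool" where
  "anti_kaehler A g J nabla \<longleftrightarrow>
     almost_anti_hermitian A g J \<and>
     (\<forall>X\<in>vector_fields A. \<forall>Y\<in>vector_fields A. cov_deriv_endo nabla J X Y = (\<lambda>p. 0))"


section \<open>Lie groups and left invariant objects\<close>

definition lie_group ::
  "('a::{t2_space,second_countable_topology}, 'e::euclidean_space) chart set \<Rightarrow>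
   ('a \<Rightarrow> 'a \<Rightarrow> 'a) \<Rightarrow> 'a \<Rightarrow> ('a \<Rightarrow> 'a) \<Rightarrow> bool" where
  "lie_group A gmult gone ginv \<longleftrightarrow>
     smooth_atlas A \<and> group gmult gone ginv \<and>
     smooth_map (prod_atlas A A) A (\<lambda>(a, b). gmult a b) \<and> smooth_map A A ginv"

definition lie_algebra ::
  "('a, 'e::real_normed_vector) chart set \<Rightarrow> ('a \<Rightarrow> 'a \<Rightarrow> 'a) \<Rightarrow> ('a \<Rightarrow> 'e) set" where
  "lie_algebra A gmult =
     {X \<in> vector_fields A. \<forall>a p. tangent_map A A (gmult a) p (X p) = X (gmult a p)}"

definition left_invariant_metric ::
  "('a, 'e::real_normed_vector) chart set \<Rightarrow> ('a \<Rightarrow> 'a \<Rightarrow> 'a) \<Rightarrow>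
   ('a \<Rightarrow> 'e \<Rightarrow> 'e \<Rightarrow> real) \<Rightarrow> bool" where
  "left_invariant_metric A gmult g \<longleftrightarrow>
     (\<forall>a p v w. g (gmult a p) (tangent_map A A (gmult a) p v) (tangent_map A A (gmult a) p w)
                = g p v w)"

definition left_invariant_endo ::
  "('a, 'e::real_normed_vector) chart set \<Rightarrow> ('a \<Rightarrow> 'a \<Rightarrow> 'a) \<Rightarrow> ('a \<Rightarrow> 'e \<Rightarrow> 'e) \<Rightarrow> bool" where
  "left_invariant_endo A gmult J \<longleftrightarrow>
     (\<forall>a p v. J (gmult a p) (tangent_map A A (gmult a) p v) = tangent_map A A (gmult a) p (J p v))"

definition left_invariant_almost_anti_hermitian ::
  "('a, 'e::real_normed_vector) chart set \<Rightarrow> ('a \<Rightarrow> 'a \<Rightarrow> 'a) \<Rightarrow>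
   ('a \<Rightarrow> 'e \<Rightarrow> 'e \<Rightarrow> real) \<Rightarrow> ('a \<Rightarrow> 'e \<Rightarrow> 'e) \<Rightarrow> bool" where
  "left_invariant_almost_anti_hermitian A gmult g J \<longleftrightarrow>
     almost_anti_hermitian A g J \<and> left_invariant_metric A gmult g \<and> left_invariant_endo A gmult J"

text \<open>
  For left invariant \<open>g\<close>, \<open>X\<close>, \<open>Y\<close> the function \<open>g(X,Y)\<close> is constant; its value is read off
  at the identity.
\<close>

definition lie_inner :: "'a \<Rightarrow> ('a \<Rightarrow> 'e \<Rightarrow> 'e \<Rightarrow> real) \<Rightarrow> ('a \<Rightarrow> 'e) \<Rightarrow> ('a \<Rightarrow> 'e) \<Rightarrow> real" where
  "lie_inner gone g X Y = g gone (X gone) (Y gone)"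


section \<open>The tensor \<open>\<theta>\<close>\<close>

definition D_field ::
  "(('a \<Rightarrow> 'e) \<Rightarrow> ('a \<Rightarrow> 'e) \<Rightarrow> 'a \<Rightarrow> 'e::real_vector) \<Rightarrow> ('a \<Rightarrow> 'e \<Rightarrow> 'e) \<Rightarrow>
   ('a \<Rightarrow> 'e) \<Rightarrow> ('a \<Rightarrow> 'e) \<Rightarrow> 'a \<Rightarrow> 'e" where
  "D_field nabla J X Y = (\<lambda>p. nabla (endo_apply J X) Y p + endo_apply J (nabla X Y) p)"

definition theta ::
  "'a \<Rightarrow> ('a \<Rightarrow> 'e \<Rightarrow> 'e \<Rightarrow> real) \<Rightarrow> (('a \<Rightarrow> 'e) \<Rightarrow> ('a \<Rightarrow> 'e) \<Rightarrow> 'a \<Rightarrow> 'e::real_vector) \<Rightarrow>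
   ('a \<Rightarrow> 'e \<Rightarrow> 'e) \<Rightarrow> ('a \<Rightarrow> 'e) \<Rightarrow> ('a \<Rightarrow> 'e) \<Rightarrow> ('a \<Rightarrow> 'e) \<Rightarrow> real" where
  "theta gone g nabla J X Y Z =
     lie_inner gone g (D_field nabla J X Y) Z +
     lie_inner gone g (D_field nabla J Y Z) X +
     lie_inner gone g (D_field nabla J Z X) Y"

definition skew_symmetric3_on :: "'v set \<Rightarrow> ('v \<Rightarrow> 'v \<Rightarrow> 'v \<Rightarrow> real) \<Rightarrow> bool" where
  "skew_symmetric3_on L T \<longleftrightarrow>
     (\<forall>X\<in>L. \<forall>Y\<in>L. \<forall>Z\<in>L.
        T Y X Z = - T X Y Z \<and> T X Z Y = - T X Y Z \<and> T Z Y X = - T X Y Z)"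

definition pure3_on :: "'v set \<Rightarrow> ('v \<Rightarrow> 'v) \<Rightarrow> ('v \<Rightarrow> 'v \<Rightarrow> 'v \<Rightarrow> real) \<Rightarrow> bool" where
  "pure3_on L K T \<longleftrightarrow>
     (\<forall>X\<in>L. \<forall>Y\<in>L. \<forall>Z\<in>L. T (K X) Y Z = T X (K Y) Z \<and> T X (K Y) Z = T X Y (K Z))"

end

(*
  Write a(X,Y,Z) = <(nabla_X J) Y, Z>.  Since nabla is metric and J^2 = -1,
  a(X,JY,Z) = - a(X,Y,JZ).  One computes that theta(X,Y,Z) + theta(X,Z,Y) is minus the cyclic
  sum of a, and that theta(JX,Y,Z) - theta(X,JY,Z) = b(Z,X,Y) - b(X,Y,Z) with
  b(X,Y,Z) = a(JX,Y,Z) + a(X,Y,JZ).  If both vanish, then c(X,Y,Z) = a(X,Y,JZ) is cyclic, while the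
  cyclic sum condition gives a(JX,Y,Z) = c(Z,X,Y) - c(Y,Z,X) = 0; hence a = 0 on the Lie algebra.
  By Koszul's formula <nabla_X Y, Z> is constant for left invariant X, Y, Z, so a = 0 at the identity
  gives nabla J = 0 on left invariant fields everywhere.  These form a global frame, and nabla J is
  linear over the smooth functions.
*)
theory Submission
  imports Defs
begin

section \<open>Calculus of smooth maps\<close>

text \<open>Most of the work lies in the geometry that the algebra presupposes. A tangent vector at
  p is a vector of the model space, read in a chart chosen at p, and this choice jumps with p.
  Smoothness of invariant fields, the chain rule and the derivative of a function along a field are
  therefore all treated by passing through a fixed chart. The bracket is given only by its action on
  local functions, so its invariance is tested on chart coordinates. Since g may be indefinite,
  frame coefficients are obtained from a basis dual with respect to g rather than from an
  orthonormal one. On the algebraic side, theta is cyclic by construction: a condition proved for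
  one pair of slots rotates to the others, which yields full skew symmetry and purity. Purity forces
  c to be cyclic because, once the cyclic sum condition is inserted, its defect is twice the
  difference of two cyclically shifted values of c.\<close>

lemma frechet_derivative_worksI:
  "f differentiable net \<Longrightarrow> (f has_derivative frechet_derivative f net) net"
  by (simp add: frechet_derivative_works[symmetric])

lemma C_diff_on_subset: "C_diff_on k f S \<Longrightarrow> T \<subseteq> S \<Longrightarrow> C_diff_on k f T"
  by (induction k arbitrary: f) (auto intro: continuous_on_subset)

text \<open>Openness turns equality on \<open>S\<close> into equality near each of its points, which
  is what two-sided derivatives require.\<close>

lemma C_diff_on_cong:
  assumes "C_diff_on k f S" "open S" "\<And>x. x \<in> S \<Longrightarrow> f x = g x"
  shows "C_diff_on k g S"
  using assms(1,3)
proof (induction k arbitrary: f g)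
  case 0
  then show ?case using continuous_on_cong[of S S f g] by simp
next
  case (Suc k)
  have d: "f differentiable (at x)" if "x \<in> S" for x
    using Suc.prems(1) that by simp
  have "g differentiable (at x)" if "x \<in> S" for x
    using has_derivative_transform_within_open[OF frechet_derivative_worksI[OF d[OF that]] assms(2) that Suc.prems(2)]
    by (simp add: differentiableI)
  moreover have "C_diff_on k (\<lambda>x. frechet_derivative g (at x) v) S" for v
  proof (rule Suc.IH)
    show "C_diff_on k (\<lambda>x. frechet_derivative f (at x) v) S"
      using Suc.prems(1) by simp
    show "frechet_derivative f (at x) v = frechet_derivative g (at x) v" if "x \<in> S" for x
      using frechet_derivative_transform_within_open[OF d[OF that] assms(2) that] Suc.prems(2) by simp
  qed
  ultimately show ?case by simp
qed

lemma C_diff_on_Suc_imp: "C_diff_on (Suc k) f S \<Longrightarrow> C_diff_on k f S"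
proof (induction k arbitrary: f)
  case 0
  then show ?case
    by (simp add: continuous_at_imp_continuous_on differentiable_imp_continuous_within)
next
  case (Suc k)
  have "C_diff_on k (\<lambda>x. frechet_derivative f (at x) v) S" for v
    using Suc.prems by (intro Suc.IH) simp
  with Suc.prems show ?case by simp
qed

lemma C_diff_on_const: "C_diff_on k (\<lambda>x. c) S"
  by (induction k arbitrary: c) auto

lemma C_diff_on_add:
  assumes "C_diff_on k f S" "C_diff_on k g S" "open S"
  shows "C_diff_on k (\<lambda>x. f x + g x) S"
  using assms(1,2)
proof (induction k arbitrary: f g)
  case 0
  then show ?case by (auto intro: continuous_on_add)
next
  case (Suc k)
  have D: "((\<lambda>x. f x + g x) has_derivative
      (\<lambda>v. frechet_derivative f (at x) v + frechet_derivative g (at x) v)) (at x)"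
    if "x \<in> S" for x
    using Suc.prems that by (intro has_derivative_add) (simp_all add: frechet_derivative_works[symmetric])
  have "C_diff_on k (\<lambda>x. frechet_derivative (\<lambda>x. f x + g x) (at x) v) S" for v
    by (rule C_diff_on_cong[OF Suc.IH[of "\<lambda>x. frechet_derivative f (at x) v"
          "\<lambda>x. frechet_derivative g (at x) v"] assms(3)])
      (use Suc.prems in \<open>auto simp: frechet_derivative_at[OF D, symmetric]\<close>)
  with D show ?case by (auto simp: differentiable_def)
qed

lemma (in bounded_linear) C_diff_on:
  assumes "C_diff_on k g S" "open S"
  shows "C_diff_on k (\<lambda>x. f (g x)) S"
  using assms(1)
proof (induction k arbitrary: g)
  case 0
  then show ?case by (auto intro: continuous_on)
next
  case (Suc k)
  have D: "((\<lambda>x. f (g x)) has_derivative (\<lambda>v. f (frechet_derivative g (at x) v))) (at x)"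
    if "x \<in> S" for x
    using Suc.prems that by (intro has_derivative) (simp add: frechet_derivative_works[symmetric])
  have "C_diff_on k (\<lambda>x. frechet_derivative (\<lambda>x. f (g x)) (at x) v) S" for v
    by (rule C_diff_on_cong[OF Suc.IH[of "\<lambda>x. frechet_derivative g (at x) v"] assms(2)])
      (use Suc.prems in \<open>auto simp: frechet_derivative_at[OF D, symmetric]\<close>)
  with D show ?case by (auto simp: differentiable_def)
qed

lemma (in bounded_bilinear) C_diff_on:
  assumes "C_diff_on k f S" "C_diff_on k g S" "open S"
  shows "C_diff_on k (\<lambda>x. prod (f x) (g x)) S"
  using assms(1,2)
proof (induction k arbitrary: f g)
  case 0
  then show ?case by (auto intro: continuous_on)
next
  case (Suc k)
  have D: "((\<lambda>x. prod (f x) (g x)) has_derivative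
      (\<lambda>v. prod (f x) (frechet_derivative g (at x) v) + prod (frechet_derivative f (at x) v) (g x))) (at x)"
    if "x \<in> S" for x
    using Suc.prems that by (intro FDERIV) (simp_all add: frechet_derivative_works[symmetric])
  have "C_diff_on k (\<lambda>x. frechet_derivative (\<lambda>x. prod (f x) (g x)) (at x) v) S" for v
  proof (rule C_diff_on_cong[OF _ assms(3)])
    show "C_diff_on k (\<lambda>x. prod (f x) (frechet_derivative g (at x) v)
                         + prod (frechet_derivative f (at x) v) (g x)) S"
      using Suc.prems C_diff_on_Suc_imp[OF Suc.prems(1)] C_diff_on_Suc_imp[OF Suc.prems(2)]
      by (intro C_diff_on_add[OF Suc.IH Suc.IH assms(3)]) simp_all
  qed (simp add: frechet_derivative_at[OF D, symmetric])
  with D show ?case by (auto simp: differentiable_def)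
qed

lemma C_diff_on_sum:
  assumes "finite I" "\<And>i. i \<in> I \<Longrightarrow> C_diff_on k (f i) S" "open S"
  shows "C_diff_on k (\<lambda>x. \<Sum>i\<in>I. f i x) S"
  using assms(1,2)
  by (induction I rule: finite_induct) (auto intro: C_diff_on_const C_diff_on_add assms(3))

text \<open>In the chain rule the derivative of \<open>f\<close> is taken in a direction that itself
  varies with \<open>x\<close>. Expanding this direction in the Euclidean basis leaves products of
  scalar coefficients with derivatives of \<open>f\<close> in constant directions, to which the
  induction hypothesis applies.\<close>

lemma C_diff_on_compose:
  fixes f :: "'b::euclidean_space \<Rightarrow> 'c::real_normed_vector"
  assumes "C_diff_on k f T" "C_diff_on k g S" "open S" "g ` S \<subseteq> T"
  shows "C_diff_on k (\<lambda>x. f (g x)) S"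
  using assms(1,2)
proof (induction k arbitrary: f)
  case 0
  with assms(4) show ?case by (auto intro: continuous_on_compose2)
next
  case (Suc k)
  have f: "(f has_derivative frechet_derivative f (at (g x))) (at (g x))" if "x \<in> S" for x
  proof -
    have "g x \<in> T" using that assms(4) by blast
    then show ?thesis using Suc.prems(1) frechet_derivative_worksI by auto
  qed
  have D: "((\<lambda>x. f (g x)) has_derivative
      (\<lambda>v. frechet_derivative f (at (g x)) (frechet_derivative g (at x) v))) (at x)"
    if "x \<in> S" for x
  proof (rule has_derivative_compose[of g _ x UNIV f])
    show "(g has_derivative frechet_derivative g (at x)) (at x)"
      using Suc.prems(2) that frechet_derivative_worksI by auto
  qed (rule f[OF that])
  have lin: "linear (frechet_derivative f (at (g x)))" if "x \<in> S" for x
    using f[OF that] by (rule has_derivative_linear)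
  have "C_diff_on k (\<lambda>x. frechet_derivative (\<lambda>x. f (g x)) (at x) v) S" for v
  proof (rule C_diff_on_cong[OF _ assms(3)])
    show "C_diff_on k (\<lambda>x. \<Sum>b\<in>Basis. (frechet_derivative g (at x) v \<bullet> b) *\<^sub>R
            frechet_derivative f (at (g x)) b) S"
    proof (intro C_diff_on_sum finite_Basis assms(3)
        bounded_bilinear.C_diff_on[OF bounded_bilinear_scaleR]
        bounded_linear.C_diff_on[OF bounded_linear_inner_left])
      fix b :: 'b
      show "C_diff_on k (\<lambda>x. frechet_derivative g (at x) v) S"
        using Suc.prems by simp
      show "C_diff_on k (\<lambda>x. frechet_derivative f (at (g x)) b) S"
        using Suc.prems C_diff_on_Suc_imp[of k g S] by (intro Suc.IH) simp_all
    qed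
  next
    fix x assume x: "x \<in> S"
    have "(\<Sum>b\<in>Basis. (frechet_derivative g (at x) v \<bullet> b) *\<^sub>R frechet_derivative f (at (g x)) b)
        = frechet_derivative f (at (g x)) (\<Sum>b\<in>Basis. (frechet_derivative g (at x) v \<bullet> b) *\<^sub>R b)"
      by (simp add: linear_sum[OF lin[OF x]] linear_scale[OF lin[OF x]])
    then show "(\<Sum>b\<in>Basis. (frechet_derivative g (at x) v \<bullet> b) *\<^sub>R frechet_derivative f (at (g x)) b)
        = frechet_derivative (\<lambda>x. f (g x)) (at x) v"
      by (simp add: euclidean_representation frechet_derivative_at[OF D[OF x], symmetric])
  qed
  with D show ?case by (auto simp: differentiable_def)
qed

text \<open>Derivatives depend only on the germ of \<open>f\<close>, so a different neighbourhood
  may be used at each point. This permits a change of target chart from point to point.\<close>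

lemma C_diff_on_local:
  assumes "\<And>x. x \<in> S \<Longrightarrow> \<exists>T. open T \<and> x \<in> T \<and> C_diff_on k f T"
  shows "C_diff_on k f S"
  using assms
proof (induction k arbitrary: f)
  case 0
  show ?case
  proof (simp, rule continuous_at_imp_continuous_on, rule ballI)
    fix x assume "x \<in> S"
    then obtain T where "open T" "x \<in> T" "continuous_on T f"
      using 0[of x] by auto
    then show "isCont f x"
      by (simp add: continuous_on_eq_continuous_at)
  qed
next
  case (Suc k)
  have "C_diff_on k (\<lambda>x. frechet_derivative f (at x) v) S" for v
    using Suc.prems by (intro Suc.IH) (metis C_diff_on.simps(2))
  moreover have "f differentiable (at x)" if "x \<in> S" for x
    using Suc.prems[OF that] by auto
  ultimately show ?case by simp
qed

section \<open>Closure properties of smooth maps, of all orders at once\<close>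

lemma smooth_on_subset: "smooth_on S f \<Longrightarrow> T \<subseteq> S \<Longrightarrow> smooth_on T f"
  unfolding smooth_on_def using C_diff_on_subset by blast

lemma smooth_on_cong: "smooth_on S f \<Longrightarrow> open S \<Longrightarrow> (\<And>x. x \<in> S \<Longrightarrow> f x = g x) \<Longrightarrow> smooth_on S g"
  unfolding smooth_on_def using C_diff_on_cong by blast

lemma smooth_on_const: "smooth_on S (\<lambda>x. c)"
  unfolding smooth_on_def using C_diff_on_const by blast

lemma smooth_on_add:
  "smooth_on S f \<Longrightarrow> smooth_on S g \<Longrightarrow> open S \<Longrightarrow> smooth_on S (\<lambda>x. f x + g x)"
  unfolding smooth_on_def using C_diff_on_add by blast

lemma smooth_on_sum:
  "finite I \<Longrightarrow> (\<And>i. i \<in> I \<Longrightarrow> smooth_on S (f i)) \<Longrightarrow> open S \<Longrightarrow> smooth_on S (\<lambda>x. \<Sum>i\<in>I. f i x)"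
  unfolding smooth_on_def by (intro allI C_diff_on_sum) auto

lemma (in bounded_linear) smooth_on:
  "smooth_on S g \<Longrightarrow> open S \<Longrightarrow> smooth_on S (\<lambda>x. f (g x))"
  unfolding smooth_on_def using C_diff_on by blast

lemma (in bounded_bilinear) smooth_on:
  "smooth_on S f \<Longrightarrow> smooth_on S g \<Longrightarrow> open S \<Longrightarrow> smooth_on S (\<lambda>x. prod (f x) (g x))"
  unfolding smooth_on_def using C_diff_on by blast

lemma smooth_on_compose:
  fixes f :: "'b::euclidean_space \<Rightarrow> 'c::real_normed_vector"
  shows "smooth_on T f \<Longrightarrow> smooth_on S g \<Longrightarrow> open S \<Longrightarrow> g ` S \<subseteq> T \<Longrightarrow> smooth_on S (\<lambda>x. f (g x))"
  unfolding smooth_on_def using C_diff_on_compose by blast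

lemma smooth_on_local:
  "(\<And>x. x \<in> S \<Longrightarrow> \<exists>T. open T \<and> x \<in> T \<and> smooth_on T f) \<Longrightarrow> smooth_on S f"
  unfolding smooth_on_def by (intro allI C_diff_on_local) blast

lemma smooth_on_ident: "smooth_on S (\<lambda>x. x)"
proof -
  have "C_diff_on k (\<lambda>x. x) S" for k
    by (cases k) (simp_all add: C_diff_on_const)
  then show ?thesis by (simp add: smooth_on_def)
qed

lemma smooth_on_differentiable: "smooth_on S f \<Longrightarrow> x \<in> S \<Longrightarrow> f differentiable (at x)"
  unfolding smooth_on_def by (metis C_diff_on.simps(2))

lemma smooth_on_frechet_derivative:
  "smooth_on S f \<Longrightarrow> smooth_on S (\<lambda>x. frechet_derivative f (at x) v)"
  unfolding smooth_on_def by (metis C_diff_on.simps(2))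

text \<open>Again the varying direction is expanded in the basis. In coordinates this is the
  smoothness of \<open>X f\<close> for a vector field \<open>X\<close>.\<close>

lemma smooth_on_derivative_along:
  fixes f :: "'b::euclidean_space \<Rightarrow> 'c::real_normed_vector"
  assumes f: "smooth_on S f" and w: "smooth_on S w" and S: "open S"
  shows "smooth_on S (\<lambda>x. frechet_derivative f (at x) (w x))"
proof -
  have "smooth_on S (\<lambda>x. (w x \<bullet> b) *\<^sub>R frechet_derivative f (at x) b)" for b
    by (rule bounded_bilinear.smooth_on[OF bounded_bilinear_scaleR
          bounded_linear.smooth_on[OF bounded_linear_inner_left w S]
          smooth_on_frechet_derivative[OF f] S])
  then have "smooth_on S (\<lambda>x. \<Sum>b\<in>Basis. (w x \<bullet> b) *\<^sub>R frechet_derivative f (at x) b)"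
    by (intro smooth_on_sum finite_Basis S)
  then show ?thesis
  proof (rule smooth_on_cong[OF _ S])
    fix x assume "x \<in> S"
    then have "linear (frechet_derivative f (at x))"
      using frechet_derivative_worksI[OF smooth_on_differentiable[OF f]] has_derivative_linear by blast
    then have "(\<Sum>b\<in>Basis. (w x \<bullet> b) *\<^sub>R frechet_derivative f (at x) b)
        = frechet_derivative f (at x) (\<Sum>b\<in>Basis. (w x \<bullet> b) *\<^sub>R b)"
      by (simp add: linear_sum linear_scale)
    then show "(\<Sum>b\<in>Basis. (w x \<bullet> b) *\<^sub>R frechet_derivative f (at x) b)
        = frechet_derivative f (at x) (w x)"
      by (simp add: euclidean_representation)
  qed
qed

text \<open>The pair is the sum of the images of its components under the two linear embeddings into
  the product.\<close>

lemma smooth_on_Pair: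
  assumes "smooth_on S f" "smooth_on S g" "open S"
  shows "smooth_on S (\<lambda>x. (f x, g x))"
proof -
  have "bounded_linear (\<lambda>x. (x, 0))" "bounded_linear (\<lambda>x. (0, x))"
    by (intro bounded_linear_Pair bounded_linear_ident bounded_linear_zero)+
  from smooth_on_add[OF bounded_linear.smooth_on[OF this(1) assms(1,3)]
      bounded_linear.smooth_on[OF this(2) assms(2,3)] assms(3)]
  show ?thesis by simp
qed

section \<open>Charts and differentials\<close>

lemma chart_inv_left: "is_chart c \<Longrightarrow> p \<in> chart_dom c \<Longrightarrow> chart_inv c (chart_map c p) = p"
  unfolding is_chart_def homeomorphism_def by blast

lemma open_chart_image:
  assumes "is_chart c" "open U"
  shows "open (chart_map c ` (chart_dom c \<inter> U))"
proof -
  have "openin (top_of_set (chart_map c ` chart_dom c)) (chart_map c ` (chart_dom c \<inter> U))"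
    using assms by (intro homeomorphism_imp_open_map[where g = "chart_inv c"])
      (auto simp: is_chart_def openin_open_Int)
  then show ?thesis
    using assms(1) openin_open_eq unfolding is_chart_def by blast
qed

text \<open>
  The model space represents the tangent space at \<^term>\<open>p\<close> through \<^term>\<open>chart_at A p\<close>, so that
  \<open>tangent_map\<close>, \<open>vf_coords\<close> and \<open>vf_apply\<close> are all instances of the following notion.
\<close>

definition has_differential ::
  "('a, 'e::real_normed_vector) chart set \<Rightarrow> ('a \<Rightarrow> 'f::real_normed_vector) \<Rightarrow> 'a \<Rightarrow>
   ('e \<Rightarrow> 'f) \<Rightarrow> bool" where
  "has_differential A f p L \<longleftrightarrow>
     (f \<circ> chart_inv (chart_at A p) has_derivative L) (at (chart_map (chart_at A p) p))"

lemma has_differential_linear: "has_differential A f p L \<Longrightarrow> linear L"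
  unfolding has_differential_def by (rule has_derivative_linear)

lemma has_differential_unique:
  "has_differential A f p L \<Longrightarrow> has_differential A f p L' \<Longrightarrow> L = L'"
  unfolding has_differential_def by (rule has_derivative_unique)

lemma has_differential_vf_apply: "has_differential A f p L \<Longrightarrow> vf_apply A X f p = L (X p)"
  unfolding has_differential_def vf_apply_def using frechet_derivative_at by metis

lemma has_differential_tangent_map:
  "has_differential A (chart_map (chart_at B (F p)) \<circ> F) p L \<Longrightarrow> tangent_map A B F p = L"
  unfolding has_differential_def tangent_map_def o_assoc
  using frechet_derivative_at by (metis (no_types) ext)

lemma smooth_map_open_vimage: "smooth_map A B F \<Longrightarrow> open U \<Longrightarrow> open (F -` U)"
  unfolding smooth_map_def continuous_on_open_vimage[OF open_UNIV] by simp

locale smooth_manifold =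
  fixes A :: "('a::{t2_space,second_countable_topology}, 'e::euclidean_space) chart set"
  assumes atlas: "smooth_atlas A"
begin

lemma is_chart: "c \<in> A \<Longrightarrow> is_chart c"
  using atlas unfolding smooth_atlas_def by blast

lemma open_chart_dom: "c \<in> A \<Longrightarrow> open (chart_dom c)"
  using is_chart unfolding is_chart_def by blast

lemma chart_at: "chart_at A p \<in> A" "p \<in> chart_dom (chart_at A p)"
proof -
  have "\<exists>c. c \<in> A \<and> p \<in> chart_dom c"
    using atlas unfolding smooth_atlas_def by blast
  then have "chart_at A p \<in> A \<and> p \<in> chart_dom (chart_at A p)"
    unfolding chart_at_def by (rule someI_ex)
  then show "chart_at A p \<in> A" "p \<in> chart_dom (chart_at A p)" by auto
qed

lemma chart_inv_chart: "c \<in> A \<Longrightarrow> p \<in> chart_dom c \<Longrightarrow> chart_inv c (chart_map c p) = p"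
  by (rule chart_inv_left[OF is_chart])

lemma open_chart_map_image: "c \<in> A \<Longrightarrow> open U \<Longrightarrow> open (chart_map c ` (chart_dom c \<inter> U))"
  by (rule open_chart_image[OF is_chart])

lemma open_chart_map_range: "c \<in> A \<Longrightarrow> open (chart_map c ` chart_dom c)"
  using is_chart unfolding is_chart_def by blast

lemma has_differential_cong:
  assumes "has_differential A f p L" "open U" "p \<in> U" "\<And>q. q \<in> U \<Longrightarrow> f q = h q"
  shows "has_differential A h p L"
  unfolding has_differential_def
proof (rule has_derivative_transform_within_open[OF assms(1)[unfolded has_differential_def]])
  let ?c = "chart_at A p"
  show "open (chart_map ?c ` (chart_dom ?c \<inter> U))"
    by (rule open_chart_map_image[OF chart_at(1) assms(2)])
  show "chart_map ?c p \<in> chart_map ?c ` (chart_dom ?c \<inter> U)"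
    using assms(3) chart_at(2) by blast
  show "(f \<circ> chart_inv ?c) x = (h \<circ> chart_inv ?c) x" if "x \<in> chart_map ?c ` (chart_dom ?c \<inter> U)" for x
    using that assms(4) chart_inv_chart[OF chart_at(1)] by auto
qed

text \<open>The chain rule, with \<open>c\<close> as an intermediate chart around
  \<open>F p\<close>. With \<open>F\<close> the identity it computes differentials in an arbitrary
  chart; with \<open>c\<close> the chart chosen at \<open>F p\<close> it is the chain rule for maps
  of the manifold.\<close>

lemma has_differential_through_chart:
  assumes "c \<in> A" "F p \<in> chart_dom c" "isCont F p"
    and "has_differential A (chart_map c \<circ> F) p T"
    and "(f \<circ> chart_inv c has_derivative L) (at (chart_map c (F p)))"
  shows "has_differential A (f \<circ> F) p (L \<circ> T)"
proof -
  let ?c = "chart_at A p"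
  obtain U where U: "open U" "p \<in> U" "\<And>q. q \<in> U \<Longrightarrow> F q \<in> chart_dom c"
    using assms(3)[unfolded continuous_at_open, rule_format, OF conjI[OF open_chart_dom[OF assms(1)] assms(2)]]
    by auto
  have "((f \<circ> chart_inv c) \<circ> (chart_map c \<circ> F \<circ> chart_inv ?c) has_derivative L \<circ> T)
      (at (chart_map ?c p))"
  proof (rule diff_chain_at)
    show "(chart_map c \<circ> F \<circ> chart_inv ?c has_derivative T) (at (chart_map ?c p))"
      using assms(4) unfolding has_differential_def .
    show "(f \<circ> chart_inv c has_derivative L)
        (at ((chart_map c \<circ> F \<circ> chart_inv ?c) (chart_map ?c p)))"
      using assms(5) chart_inv_chart[OF chart_at] by simp
  qed
  then have "has_differential A (f \<circ> (chart_inv c \<circ> (chart_map c \<circ> F))) p (L \<circ> T)"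
    unfolding has_differential_def by (simp only: o_assoc)
  \<comment> \<open>Going to the chart and back is the identity only on the domain of
    \<open>c\<close>. Continuity of \<open>F\<close> keeps a neighbourhood of \<open>p\<close>
    inside it, and differentials are local.\<close>
  then show ?thesis
    by (rule has_differential_cong[OF _ U(1,2)]) (simp add: U(3) chart_inv_chart assms(1))
qed

lemma has_differential_chart_map:
  assumes "c \<in> A" "p \<in> chart_dom c"
  shows "has_differential A (chart_map c) p
    (frechet_derivative (chart_map c \<circ> chart_inv (chart_at A p)) (at (chart_map (chart_at A p) p)))"
  unfolding has_differential_def
proof (rule frechet_derivative_worksI, rule smooth_on_differentiable)
  show "smooth_on (chart_map (chart_at A p) ` (chart_dom (chart_at A p) \<inter> chart_dom c))
      (chart_map c \<circ> chart_inv (chart_at A p))"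
    using atlas assms(1) chart_at(1) unfolding smooth_atlas_def by blast
  show "chart_map (chart_at A p) p \<in> chart_map (chart_at A p) ` (chart_dom (chart_at A p) \<inter> chart_dom c)"
    using assms(2) chart_at(2) by blast
qed

lemma has_differential_vf_coords:
  assumes "c \<in> A" "p \<in> chart_dom c" "has_differential A (chart_map c) p T"
  shows "vf_coords A c X (chart_map c p) = T (X p)"
  using assms(3) chart_inv_chart[OF assms(1,2)]
  unfolding vf_coords_def Let_def has_differential_def by (metis frechet_derivative_at)

text \<open>This expresses the identification of the tangent space at \<open>p\<close> with the
  model space.\<close>

lemma has_differential_chart_at: "has_differential A (chart_map (chart_at A p)) p (\<lambda>v. v)"
  unfolding has_differential_def
proof (rule has_derivative_transform_within_open[OF has_derivative_ident])
  show "open (chart_map (chart_at A p) ` chart_dom (chart_at A p))"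
    by (rule open_chart_map_range[OF chart_at(1)])
qed (use chart_at in \<open>auto simp: chart_inv_chart[OF chart_at(1)]\<close>)

lemma has_differential_chart:
  assumes "c \<in> A" "p \<in> chart_dom c"
    and "(f \<circ> chart_inv c has_derivative L) (at (chart_map c p))"
  shows "has_differential A f p
    (\<lambda>v. L (frechet_derivative (chart_map c \<circ> chart_inv (chart_at A p)) (at (chart_map (chart_at A p) p)) v))"
  using has_differential_through_chart[where F = "\<lambda>q. q", OF assms(1,2) _ _ assms(3)]
    has_differential_chart_map[OF assms(1,2)]
  by (simp add: o_def)

lemma has_differential_smooth_fun:
  assumes "smooth_fun A U f" "p \<in> U"
  shows "has_differential A f p
    (frechet_derivative (f \<circ> chart_inv (chart_at A p)) (at (chart_map (chart_at A p) p)))"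
  unfolding has_differential_def
  using assms chart_at unfolding smooth_fun_def
  by (intro frechet_derivative_worksI smooth_on_differentiable) auto

lemma smooth_fun_chart_coordinate:
  assumes "c \<in> A"
  shows "smooth_fun A (chart_dom c) (\<lambda>q. chart_map c q \<bullet> b)"
  unfolding smooth_fun_def
proof
  fix d assume d: "d \<in> A"
  have "smooth_on (chart_map d ` (chart_dom d \<inter> chart_dom c)) (chart_map c \<circ> chart_inv d)"
    using atlas assms d unfolding smooth_atlas_def by blast
  then have "smooth_on (chart_map d ` (chart_dom d \<inter> chart_dom c))
      (\<lambda>x. (chart_map c \<circ> chart_inv d) x \<bullet> b)"
    by (rule bounded_linear.smooth_on[OF bounded_linear_inner_left])
      (simp add: open_chart_map_image d open_chart_dom assms)
  then show "smooth_on (chart_map d ` (chart_dom d \<inter> chart_dom c))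
      ((\<lambda>q. chart_map c q \<bullet> b) \<circ> chart_inv d)"
    by (simp add: o_def)
qed

text \<open>These functions recover the components of a tangent vector at \<open>p\<close>, and so
  serve as test functions for equality of tangent vectors.\<close>

lemma has_differential_chart_coordinate:
  "has_differential A (\<lambda>q. chart_map (chart_at A p) q \<bullet> b) p (\<lambda>v. v \<bullet> b)"
  using bounded_linear.has_derivative[OF bounded_linear_inner_left
      has_differential_chart_at[unfolded has_differential_def]]
  by (simp add: has_differential_def o_def)

lemma has_differential_smooth_map:
  assumes "smooth_map A A F"
  shows "has_differential A (chart_map (chart_at A (F p)) \<circ> F) p (tangent_map A A F p)"
proof -
  let ?c = "chart_at A p" and ?d = "chart_at A (F p)"
  have "(chart_map ?d \<circ> F \<circ> chart_inv ?c) differentiable (at (chart_map ?c p))"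
    using assms chart_at unfolding smooth_map_def
    by (intro smooth_on_differentiable[of "chart_map ?c ` (chart_dom ?c \<inter> F -` chart_dom ?d)"]) auto
  then have "has_differential A (chart_map ?d \<circ> F) p
    (frechet_derivative (chart_map ?d \<circ> F \<circ> chart_inv ?c) (at (chart_map ?c p)))"
    unfolding has_differential_def by (rule frechet_derivative_worksI)
  then show ?thesis
    by (simp add: has_differential_tangent_map)
qed

lemma has_differential_compose:
  assumes "smooth_map A A F" "has_differential A f (F p) L"
  shows "has_differential A (f \<circ> F) p (\<lambda>v. L (tangent_map A A F p v))"
proof -
  have "isCont F p"
    using assms(1) unfolding smooth_map_def by (simp add: continuous_on_eq_continuous_at)
  from has_differential_through_chart[where F = F, OF chart_at this
      has_differential_smooth_map[OF assms(1)] assms(2)[unfolded has_differential_def]]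
  show ?thesis by (simp add: o_def)
qed

lemma tangent_map_compose:
  assumes "smooth_map A A F" "smooth_map A A G"
  shows "tangent_map A A (G \<circ> F) p v = tangent_map A A G (F p) (tangent_map A A F p v)"
proof -
  have "has_differential A (chart_map (chart_at A ((G \<circ> F) p)) \<circ> (G \<circ> F)) p
      (\<lambda>v. tangent_map A A G (F p) (tangent_map A A F p v))"
    using has_differential_compose[OF assms(1) has_differential_smooth_map[OF assms(2)]]
    unfolding o_def .
  then show ?thesis by (simp add: has_differential_tangent_map)
qed

lemma tangent_map_ident: "tangent_map A A (\<lambda>q. q) p v = v"
  using has_differential_chart_at[of p] by (subst has_differential_tangent_map) (auto simp: o_def)

lemma smooth_fun_compose:
  assumes "smooth_map A A F" "smooth_fun A U f" "open U"
  shows "smooth_fun A (F -` U) (f \<circ> F)"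
  unfolding smooth_fun_def
proof
  fix c assume c: "c \<in> A"
  show "smooth_on (chart_map c ` (chart_dom c \<inter> F -` U)) (f \<circ> F \<circ> chart_inv c)"
  proof (rule smooth_on_local)
    fix x assume "x \<in> chart_map c ` (chart_dom c \<inter> F -` U)"
    then obtain p where p: "p \<in> chart_dom c" "F p \<in> U" "x = chart_map c p" by auto
    \<comment> \<open>The image of the domain of \<open>c\<close> need not lie in a single chart, so
      the target chart is chosen separately near each point.\<close>
    define d where "d = chart_at A (F p)"
    have d: "d \<in> A" "F p \<in> chart_dom d" using chart_at by (auto simp: d_def)
    define T where "T = chart_map c ` (chart_dom c \<inter> F -` (chart_dom d \<inter> U))"
    have T: "open T"
      unfolding T_def by (intro open_chart_map_image c smooth_map_open_vimage[OF assms(1)] open_Int open_chart_dom d assms)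
    have "smooth_on T (\<lambda>x. (f \<circ> chart_inv d) ((chart_map d \<circ> F \<circ> chart_inv c) x))"
    proof (rule smooth_on_compose[where f = "f \<circ> chart_inv d" and g = "chart_map d \<circ> F \<circ> chart_inv c", OF _ _ T])
      show "smooth_on (chart_map d ` (chart_dom d \<inter> U)) (f \<circ> chart_inv d)"
        using assms(2) d unfolding smooth_fun_def by blast
      show "smooth_on T (chart_map d \<circ> F \<circ> chart_inv c)"
      proof (rule smooth_on_subset)
        show "smooth_on (chart_map c ` (chart_dom c \<inter> F -` chart_dom d)) (chart_map d \<circ> F \<circ> chart_inv c)"
          using assms(1) c d(1) unfolding smooth_map_def by blast
      qed (auto simp: T_def)
      show "(chart_map d \<circ> F \<circ> chart_inv c) ` T \<subseteq> chart_map d ` (chart_dom d \<inter> U)"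
        by (auto simp: T_def chart_inv_chart[OF c])
    qed
    then have "smooth_on T (f \<circ> F \<circ> chart_inv c)"
      by (rule smooth_on_cong[OF _ T])
        (auto simp: T_def chart_inv_chart[OF c] chart_inv_chart[OF d(1)])
    moreover have "x \<in> T" using p d by (auto simp: T_def)
    ultimately show "\<exists>T. open T \<and> x \<in> T \<and> smooth_on T (f \<circ> F \<circ> chart_inv c)"
      using T by blast
  qed
qed

lemma smooth_fun_vf_apply:
  assumes "smooth_fun A U f" "open U" "X \<in> vector_fields A"
  shows "smooth_fun A U (vf_apply A X f)"
  unfolding smooth_fun_def
proof
  fix c assume c: "c \<in> A"
  define S where "S = chart_map c ` (chart_dom c \<inter> U)"
  have S: "open S" unfolding S_def by (rule open_chart_map_image[OF c assms(2)])
  have f: "smooth_on S (f \<circ> chart_inv c)"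
    using assms(1) c unfolding smooth_fun_def S_def by blast
  have X: "smooth_on S (vf_coords A c X)"
  proof (rule smooth_on_subset)
    show "smooth_on (chart_map c ` chart_dom c) (vf_coords A c X)"
      using assms(3) c unfolding vector_fields_def by blast
  qed (auto simp: S_def)
  have "smooth_on S (\<lambda>x. frechet_derivative (f \<circ> chart_inv c) (at x) (vf_coords A c X x))"
    by (rule smooth_on_derivative_along[OF f X S])
  then show "smooth_on (chart_map c ` (chart_dom c \<inter> U)) (vf_apply A X f \<circ> chart_inv c)"
    unfolding S_def[symmetric]
  proof (rule smooth_on_cong[OF _ S])
    fix x assume x: "x \<in> S"
    then obtain p where p: "p \<in> chart_dom c" "p \<in> U" "x = chart_map c p"
      by (auto simp: S_def)
    let ?L = "frechet_derivative (f \<circ> chart_inv c) (at x)"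
    have L: "(f \<circ> chart_inv c has_derivative ?L) (at (chart_map c p))"
      using frechet_derivative_worksI[OF smooth_on_differentiable[OF f x]] p(3) by simp
    \<comment> \<open>Both sides are the differential of \<open>f\<close> at \<open>p\<close>
      applied to \<open>X p\<close>. The chain rule replaces the chart chosen at \<open>p\<close> by
      the fixed chart \<open>c\<close>.\<close>
    have "vf_apply A X f p = ?L (vf_coords A c X x)"
      unfolding has_differential_vf_apply[OF has_differential_chart[OF c p(1) L]] p(3)
        has_differential_vf_coords[OF c p(1) has_differential_chart_map[OF c p(1)]] ..
    then show "?L (vf_coords A c X x) = (vf_apply A X f \<circ> chart_inv c) x"
      using chart_inv_chart[OF c p(1)] p(3) by simp
  qed
qed

section \<open>Vector fields as a module over the smooth functions\<close>

lemma vf_coords_add: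
  assumes c: "c \<in> A" and x: "x \<in> chart_map c ` chart_dom c"
  shows "vf_coords A c (\<lambda>p. X p + Y p) x = vf_coords A c X x + vf_coords A c Y x"
proof -
  obtain p where p: "p \<in> chart_dom c" "x = chart_map c p" using x by blast
  note T = has_differential_chart_map[OF c p(1)]
  show ?thesis
    unfolding p(2) has_differential_vf_coords[OF c p(1) T]
    by (rule linear_add[OF has_differential_linear[OF T]])
qed

lemma vf_coords_scaleR:
  assumes c: "c \<in> A" and x: "x \<in> chart_map c ` chart_dom c"
  shows "vf_coords A c (\<lambda>p. f p *\<^sub>R X p) x = f (chart_inv c x) *\<^sub>R vf_coords A c X x"
proof -
  obtain p where p: "p \<in> chart_dom c" "x = chart_map c p" using x by blast
  note T = has_differential_chart_map[OF c p(1)]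
  show ?thesis
    unfolding p(2) has_differential_vf_coords[OF c p(1) T] chart_inv_chart[OF c p(1)]
    by (rule linear_scale[OF has_differential_linear[OF T]])
qed

lemma vector_fields_add:
  assumes "X \<in> vector_fields A" "Y \<in> vector_fields A"
  shows "(\<lambda>p. X p + Y p) \<in> vector_fields A"
  unfolding vector_fields_def
proof (intro CollectI ballI)
  fix c assume c: "c \<in> A"
  show "smooth_on (chart_map c ` chart_dom c) (vf_coords A c (\<lambda>p. X p + Y p))"
    by (rule smooth_on_cong[OF smooth_on_add[of _ "vf_coords A c X" "vf_coords A c Y"]])
      (use assms c in \<open>auto simp: vector_fields_def open_chart_map_range vf_coords_add\<close>)
qed

lemma vector_fields_scaleR:
  assumes "X \<in> vector_fields A" "smooth_fun A UNIV f"
  shows "(\<lambda>p. f p *\<^sub>R X p) \<in> vector_fields A"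
  unfolding vector_fields_def
proof (intro CollectI ballI)
  fix c assume c: "c \<in> A"
  have "smooth_on (chart_map c ` chart_dom c) (\<lambda>x. (f \<circ> chart_inv c) x *\<^sub>R vf_coords A c X x)"
    using assms c open_chart_map_range[OF c] unfolding vector_fields_def smooth_fun_def
    by (intro bounded_bilinear.smooth_on[OF bounded_bilinear_scaleR]) (simp_all del: comp_apply)
  then show "smooth_on (chart_map c ` chart_dom c) (vf_coords A c (\<lambda>p. f p *\<^sub>R X p))"
    by (rule smooth_on_cong) (use c in \<open>auto simp: open_chart_map_range vf_coords_scaleR\<close>)
qed

lemma smooth_fun_const: "smooth_fun A U (\<lambda>p. k)"
  by (simp add: smooth_fun_def o_def smooth_on_const)

lemma vf_apply_const: "vf_apply A X (\<lambda>p. k) = (\<lambda>p. 0)"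
  by (simp add: vf_apply_def o_def fun_eq_iff)

end

section \<open>Left invariant vector fields\<close>

locale smooth_group = smooth_manifold A
  for A :: "('a::{t2_space,second_countable_topology}, 'e::euclidean_space) chart set" +
  fixes gmult :: "'a \<Rightarrow> 'a \<Rightarrow> 'a" and gone :: 'a and ginv :: "'a \<Rightarrow> 'a"
  assumes lie_group: "lie_group A gmult gone ginv"
begin

sublocale grp: group gmult gone ginv
  using lie_group unfolding lie_group_def by blast

text \<open>The inverse charts of the two factors appear separately, in place of the inverse of the
  product chart, so that one factor can be held fixed.\<close>

definition mult_coords :: "('a, 'e) chart \<Rightarrow> ('a, 'e) chart \<Rightarrow> ('a, 'e) chart \<Rightarrow> 'e \<times> 'e \<Rightarrow> 'e" where
  "mult_coords b c d = (\<lambda>(x, y). chart_map d (gmult (chart_inv b x) (chart_inv c y)))"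

definition mult_coords_dom :: "('a, 'e) chart \<Rightarrow> ('a, 'e) chart \<Rightarrow> ('a, 'e) chart \<Rightarrow> ('e \<times> 'e) set" where
  "mult_coords_dom b c d =
     {(chart_map b p, chart_map c q) | p q.
        p \<in> chart_dom b \<and> q \<in> chart_dom c \<and> gmult p q \<in> chart_dom d}"

lemma mult_coords_domI:
  "p \<in> chart_dom b \<Longrightarrow> q \<in> chart_dom c \<Longrightarrow> gmult p q \<in> chart_dom d \<Longrightarrow>
    (chart_map b p, chart_map c q) \<in> mult_coords_dom b c d"
  unfolding mult_coords_dom_def by blast

lemma mult_smooth_map: "smooth_map (prod_atlas A A) A (\<lambda>(a, b). gmult a b)"
  using lie_group unfolding lie_group_def by blast

lemma open_mult_coords_dom:
  assumes b: "b \<in> A" and c: "c \<in> A" and d: "d \<in> A"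
  shows "open (mult_coords_dom b c d)"
proof -
  have op: "open {pq. case pq of (p, q) \<Rightarrow> gmult p q \<in> chart_dom d}"
    using smooth_map_open_vimage[OF mult_smooth_map open_chart_dom[OF d]]
    by (simp add: vimage_def case_prod_unfold)
  show ?thesis
  proof (rule openI)
    fix z assume "z \<in> mult_coords_dom b c d"
    then obtain p q where pq: "z = (chart_map b p, chart_map c q)" "p \<in> chart_dom b"
      "q \<in> chart_dom c" "gmult p q \<in> chart_dom d" unfolding mult_coords_dom_def by blast
    have "(p, q) \<in> {pq. case pq of (p, q) \<Rightarrow> gmult p q \<in> chart_dom d}"
      using pq(4) by simp
    from open_prod_elim[OF op this] obtain U V where UV: "open U" "open V" "p \<in> U" "q \<in> V"
      "U \<times> V \<subseteq> {pq. case pq of (p, q) \<Rightarrow> gmult p q \<in> chart_dom d}"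
      by (metis mem_Sigma_iff)
    let ?W = "(chart_map b ` (chart_dom b \<inter> U)) \<times> (chart_map c ` (chart_dom c \<inter> V))"
    have "open ?W" by (intro open_Times open_chart_map_image b c UV)
    moreover have "z \<in> ?W" using pq UV by blast
    moreover have "?W \<subseteq> mult_coords_dom b c d"
      using UV(5) unfolding mult_coords_dom_def by blast
    ultimately show "\<exists>e>0. ball z e \<subseteq> mult_coords_dom b c d"
      by (meson open_contains_ball order_trans)
  qed
qed

lemma smooth_on_mult_coords:
  assumes b: "b \<in> A" and c: "c \<in> A" and d: "d \<in> A"
  shows "smooth_on (mult_coords_dom b c d) (mult_coords b c d)"
proof -
  define bc :: "('a \<times> 'a, 'e \<times> 'e) chart"
    where "bc = (chart_dom b \<times> chart_dom c, map_prod (chart_map b) (chart_map c))"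
  have bc: "bc \<in> prod_atlas A A" unfolding bc_def prod_atlas_def using b c by blast
  \<comment> \<open>\<open>chart_inv\<close> of the product chart is an arbitrary
    \<open>inv_into\<close>; injectivity identifies it with the pair of inverses.\<close>
  have "inj_on (chart_map b) (chart_dom b)" "inj_on (chart_map c) (chart_dom c)"
    using chart_inv_chart b c by (metis inj_onI)+
  then have "inj_on (chart_map bc) (chart_dom bc)"
    by (auto simp: bc_def inj_on_def)
  then have inv: "chart_inv bc (chart_map b p, chart_map c q) = (p, q)"
    if "p \<in> chart_dom b" "q \<in> chart_dom c" for p q
    using inv_into_f_f[of "chart_map bc" "chart_dom bc" "(p, q)"] that
    by (simp add: bc_def chart_inv_def)
  have dom: "chart_map bc ` (chart_dom bc \<inter> (\<lambda>(a, b). gmult a b) -` chart_dom d) = mult_coords_dom b c d"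
    unfolding bc_def mult_coords_dom_def by force
  have "smooth_on (mult_coords_dom b c d) (chart_map d \<circ> (\<lambda>(a, b). gmult a b) \<circ> chart_inv bc)"
    using mult_smooth_map bc d unfolding smooth_map_def dom[symmetric] by blast
  then show ?thesis
    by (rule smooth_on_cong[OF _ open_mult_coords_dom[OF assms]])
      (auto simp: mult_coords_dom_def mult_coords_def inv chart_inv_chart b c)
qed

lemma smooth_map_left_mult: "smooth_map A A (gmult a)"
proof -
  have "continuous_on UNIV (\<lambda>(a, b). gmult a b)"
    using mult_smooth_map unfolding smooth_map_def by blast
  then have "continuous_on UNIV (\<lambda>q. (\<lambda>(a, b). gmult a b) (a, q))"
    by (rule continuous_on_compose2) (auto intro!: continuous_intros)
  then have cont: "continuous_on UNIV (gmult a)" by simp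
  have "smooth_on (chart_map c ` (chart_dom c \<inter> gmult a -` chart_dom d))
      (chart_map d \<circ> gmult a \<circ> chart_inv c)" if c: "c \<in> A" and d: "d \<in> A" for c d
  proof -
    define b where "b = chart_at A a"
    have b: "b \<in> A" "a \<in> chart_dom b" using chart_at by (auto simp: b_def)
    define S where "S = chart_map c ` (chart_dom c \<inter> gmult a -` chart_dom d)"
    have S: "open S"
      unfolding S_def
      by (rule open_chart_map_image[OF c open_vimage[OF open_chart_dom[OF d] cont]])
    \<comment> \<open>In coordinates, left translation by \<open>a\<close> is the restriction of
      multiplication to a slice.\<close>
    have "smooth_on S (\<lambda>x. mult_coords b c d (chart_map b a, x))"
    proof (rule smooth_on_compose[OF smooth_on_mult_coords[OF b(1) c d] _ S])
      show "smooth_on S (\<lambda>x. (chart_map b a, x))"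
        by (intro smooth_on_Pair smooth_on_const smooth_on_ident S)
      show "(\<lambda>x. (chart_map b a, x)) ` S \<subseteq> mult_coords_dom b c d"
        using b(2) by (auto simp: S_def intro!: mult_coords_domI)
    qed
    then show ?thesis
      unfolding S_def[symmetric]
      by (rule smooth_on_cong[OF _ S]) (simp add: mult_coords_def chart_inv_chart b)
  qed
  with cont show ?thesis unfolding smooth_map_def by blast
qed

section \<open>Left invariant extensions of tangent vectors at the identity\<close>

definition left_inv_field :: "'e \<Rightarrow> 'a \<Rightarrow> 'e" where
  "left_inv_field v p = tangent_map A A (gmult p) gone v"

lemma left_mult_compose: "gmult a \<circ> gmult p = gmult (gmult a p)"
  by (simp add: fun_eq_iff grp.assoc)

lemma tangent_map_left_mult:
  "tangent_map A A (gmult (gmult a p)) q v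
     = tangent_map A A (gmult a) (gmult p q) (tangent_map A A (gmult p) q v)"
  using tangent_map_compose[OF smooth_map_left_mult smooth_map_left_mult]
  by (simp only: left_mult_compose)

lemma tangent_map_gone: "tangent_map A A (gmult gone) p v = v"
proof -
  have "gmult gone = (\<lambda>q. q)" by (simp add: fun_eq_iff grp.group_left_neutral)
  then show ?thesis by (simp only: tangent_map_ident)
qed

lemma linear_tangent_map_left_mult: "linear (tangent_map A A (gmult a) p)"
  using has_differential_smooth_map[OF smooth_map_left_mult] by (rule has_differential_linear)

text \<open>The charts in the definition of the field jump with \<open>p\<close>. In a fixed chart
  its components are instead the partial derivative of multiplication in the second factor at the
  identity, which is manifestly smooth in \<open>x\<close>. Since \<open>gmult p gone\<close> is
  \<open>p\<close>, the chart \<open>c\<close> serves for both the first factor and the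
  product.\<close>

lemma vf_coords_left_inv_field:
  assumes c: "c \<in> A" and x: "x \<in> chart_map c ` chart_dom c"
  shows "vf_coords A c (left_inv_field v) x =
    frechet_derivative (mult_coords c (chart_at A gone) c)
      (at (x, chart_map (chart_at A gone) gone)) (0, v)"
proof -
  define e where "e = chart_at A gone"
  obtain p where p: "p \<in> chart_dom c" "x = chart_map c p" using x by blast
  have e: "e \<in> A" "gone \<in> chart_dom e" using chart_at by (auto simp: e_def)
  let ?M = "mult_coords c e c" and ?y = "chart_map e gone"
  let ?D = "frechet_derivative ?M (at (x, ?y))"
  have "(x, ?y) \<in> mult_coords_dom c e c"
    using p e by (auto intro!: mult_coords_domI)
  then have "(?M has_derivative ?D) (at (x, ?y))"
    by (intro frechet_derivative_worksI smooth_on_differentiable[OF smooth_on_mult_coords[OF c e(1) c]])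
  moreover have "((\<lambda>y. (x, y)) has_derivative (\<lambda>w. (0, w))) (at ?y)"
    by (auto intro!: derivative_eq_intros)
  ultimately have "((\<lambda>y. ?M (x, y)) has_derivative (\<lambda>w. ?D (0, w))) (at ?y)"
    using has_derivative_compose[of "\<lambda>y. (x, y)" _ ?y UNIV ?M ?D] by blast
  moreover have "(\<lambda>y. ?M (x, y)) = chart_map c \<circ> gmult p \<circ> chart_inv e"
    by (simp add: mult_coords_def p chart_inv_chart[OF c p(1)] fun_eq_iff)
  ultimately have 1: "has_differential A (chart_map c \<circ> gmult p) gone (\<lambda>w. ?D (0, w))"
    unfolding has_differential_def e_def by simp
  \<comment> \<open>The same differential is now computed by the chain rule; uniqueness compares the
    two results.\<close>
  obtain T where T: "has_differential A (chart_map c) p T"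
    using has_differential_chart_map[OF c p(1)] by blast
  have "has_differential A (chart_map c \<circ> gmult p) gone (\<lambda>w. T (tangent_map A A (gmult p) gone w))"
    by (rule has_differential_compose[OF smooth_map_left_mult]) (simp add: T)
  then have "?D (0, v) = T (left_inv_field v p)"
    using has_differential_unique[OF 1] unfolding left_inv_field_def by metis
  also have "\<dots> = vf_coords A c (left_inv_field v) x"
    using has_differential_vf_coords[OF c p(1) T] p(2) by simp
  finally show ?thesis by (simp add: e_def)
qed

lemma left_inv_field_vector_field: "left_inv_field v \<in> vector_fields A"
  unfolding vector_fields_def
proof (intro CollectI ballI)
  fix c assume c: "c \<in> A"
  define e where "e = chart_at A gone"
  have e: "e \<in> A" "gone \<in> chart_dom e" using chart_at by (auto simp: e_def)
  have S: "open (chart_map c ` chart_dom c)" by (rule open_chart_map_range[OF c])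
  have "smooth_on (chart_map c ` chart_dom c)
      (\<lambda>x. frechet_derivative (mult_coords c e c) (at (x, chart_map e gone)) (0, v))"
  proof (rule smooth_on_compose[where f = "\<lambda>z. frechet_derivative (mult_coords c e c) (at z) (0, v)",
        OF smooth_on_frechet_derivative[OF smooth_on_mult_coords[OF c e(1) c]] _ S])
    show "smooth_on (chart_map c ` chart_dom c) (\<lambda>x. (x, chart_map e gone))"
      by (intro smooth_on_Pair smooth_on_const smooth_on_ident S)
    show "(\<lambda>x. (x, chart_map e gone)) ` chart_map c ` chart_dom c \<subseteq> mult_coords_dom c e c"
      using e(2) by (auto intro!: mult_coords_domI)
  qed
  then show "smooth_on (chart_map c ` chart_dom c) (vf_coords A c (left_inv_field v))"
    by (rule smooth_on_cong[OF _ S]) (simp add: vf_coords_left_inv_field[OF c] e_def)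
qed

lemma left_inv_field_left_invariant:
  "tangent_map A A (gmult a) p (left_inv_field v p) = left_inv_field v (gmult a p)"
  unfolding left_inv_field_def using tangent_map_left_mult[of a p gone v] by simp

lemma left_inv_field_lie_algebra: "left_inv_field v \<in> lie_algebra A gmult"
  unfolding lie_algebra_def
  using left_inv_field_vector_field left_inv_field_left_invariant by blast

lemma left_inv_field_gone: "left_inv_field v gone = v"
  unfolding left_inv_field_def by (rule tangent_map_gone)

text \<open>The preimage of \<open>w\<close> is its translate back to the identity by the inverse of
  \<open>p\<close>. Thus a statement about all tangent vectors at \<open>p\<close> can be checked on
  left invariant fields.\<close>

lemma left_inv_field_surj: "\<exists>v. left_inv_field v p = w"
proof
  show "left_inv_field (tangent_map A A (gmult (ginv p)) p w) p = w"
    using tangent_map_left_mult[of p "ginv p" p w] by (simp add: left_inv_field_def tangent_map_gone)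
qed

lemma lie_algebra_vector_field: "X \<in> lie_algebra A gmult \<Longrightarrow> X \<in> vector_fields A"
  by (simp add: lie_algebra_def)

lemma lie_algebra_left_invariant:
  "X \<in> lie_algebra A gmult \<Longrightarrow> tangent_map A A (gmult a) p (X p) = X (gmult a p)"
  by (simp add: lie_algebra_def)

lemma linear_left_inv_field: "linear (\<lambda>v. left_inv_field v p)"
  unfolding left_inv_field_def by (rule linear_tangent_map_left_mult)

section \<open>Brackets of left invariant fields\<close>

lemma vf_apply_left_translate:
  assumes X: "X \<in> lie_algebra A gmult" and f: "smooth_fun A U f" and p: "gmult a p \<in> U"
  shows "vf_apply A X (f \<circ> gmult a) p = vf_apply A X f (gmult a p)"
proof -
  note L = has_differential_smooth_fun[OF f p]
  show ?thesis
    using has_differential_vf_apply[OF has_differential_compose[OF smooth_map_left_mult L]]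
      has_differential_vf_apply[OF L] lie_algebra_left_invariant[OF X] by simp
qed

lemma vf_apply_cong:
  assumes "has_differential A f p L" "open U" "p \<in> U" "\<And>q. q \<in> U \<Longrightarrow> f q = h q"
  shows "vf_apply A X f p = vf_apply A X h p"
  using has_differential_vf_apply[OF assms(1)]
    has_differential_vf_apply[OF has_differential_cong[OF assms]] by simp

text \<open>Translation is moved past \<open>Y\<close> and then past \<open>X\<close>. The outer
  derivative needs the inner identity on a neighbourhood of \<open>p\<close>, which the preimage of
  \<open>U\<close> provides.\<close>

lemma vf_apply_twice_left_translate:
  assumes X: "X \<in> lie_algebra A gmult" and Y: "Y \<in> lie_algebra A gmult"
    and f: "smooth_fun A U f" and U: "open U" and p: "gmult a p \<in> U"
  shows "vf_apply A X (vf_apply A Y (f \<circ> gmult a)) p = vf_apply A X (vf_apply A Y f) (gmult a p)"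
proof -
  have Yf: "smooth_fun A U (vf_apply A Y f)"
    by (rule smooth_fun_vf_apply[OF f U lie_algebra_vector_field[OF Y]])
  note op = smooth_map_open_vimage[OF smooth_map_left_mult U]
  have "vf_apply A X (vf_apply A Y f \<circ> gmult a) p = vf_apply A X (vf_apply A Y (f \<circ> gmult a)) p"
    by (rule vf_apply_cong[OF has_differential_compose[OF smooth_map_left_mult
          has_differential_smooth_fun[OF Yf p]] op])
      (use p vf_apply_left_translate[OF Y f] in auto)
  then show ?thesis using vf_apply_left_translate[OF X Yf p] by simp
qed

text \<open>\<open>X\<close> and \<open>Y\<close> commute with composition by left translations,
  hence so does their commutator, which is the action of \<open>Z\<close> on functions. Applying it
  to coordinates around \<open>gmult a p\<close> compares the two tangent vectors
  componentwise.\<close>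

lemma lie_bracket_left_invariant:
  assumes X: "X \<in> lie_algebra A gmult" and Y: "Y \<in> lie_algebra A gmult"
    and Z: "is_lie_bracket A X Y Z"
  shows "Z \<in> lie_algebra A gmult"
proof -
  have "tangent_map A A (gmult a) p (Z p) = Z (gmult a p)" for a p
  proof (rule euclidean_eqI)
    fix b :: 'e
    define c where "c = chart_at A (gmult a p)"
    define f where "f = (\<lambda>q. chart_map c q \<bullet> b)"
    have c: "c \<in> A" "gmult a p \<in> chart_dom c" using chart_at by (auto simp: c_def)
    note U = open_chart_dom[OF c(1)]
    have f: "smooth_fun A (chart_dom c) f"
      unfolding f_def by (rule smooth_fun_chart_coordinate[OF c(1)])
    have L: "has_differential A f (gmult a p) (\<lambda>v. v \<bullet> b)"
      unfolding f_def c_def by (rule has_differential_chart_coordinate)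
    note fa = smooth_fun_compose[OF smooth_map_left_mult f U]
      and op = smooth_map_open_vimage[OF smooth_map_left_mult U]
    have Z': "vf_apply A Z h q = vf_apply A X (vf_apply A Y h) q - vf_apply A Y (vf_apply A X h) q"
      if "open V" "smooth_fun A V h" "q \<in> V" for V h q
      using Z that unfolding is_lie_bracket_def by blast
    have "tangent_map A A (gmult a) p (Z p) \<bullet> b = vf_apply A Z (f \<circ> gmult a) p"
      using has_differential_vf_apply[OF has_differential_compose[OF smooth_map_left_mult L]] by simp
    also have "\<dots> = vf_apply A X (vf_apply A Y (f \<circ> gmult a)) p
        - vf_apply A Y (vf_apply A X (f \<circ> gmult a)) p"
      using Z'[OF op fa, of p] c(2) by simp
    also have "\<dots> = vf_apply A X (vf_apply A Y f) (gmult a p) - vf_apply A Y (vf_apply A X f) (gmult a p)"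
      using vf_apply_twice_left_translate[OF X Y f U c(2)] vf_apply_twice_left_translate[OF Y X f U c(2)]
      by simp
    also have "\<dots> = vf_apply A Z f (gmult a p)"
      using Z'[OF U f c(2)] by simp
    also have "\<dots> = Z (gmult a p) \<bullet> b"
      by (rule has_differential_vf_apply[OF L])
    finally show "tangent_map A A (gmult a) p (Z p) \<bullet> b = Z (gmult a p) \<bullet> b" .
  qed
  then show ?thesis
    using Z unfolding lie_algebra_def is_lie_bracket_def by blast
qed

end

section \<open>The algebraic core\<close>

text \<open>
  \<open>\<Gamma> X Y Z\<close> stands for \<open>\<langle>\<nabla>\<^sub>X Y, Z\<rangle>\<close> on the Lie algebra \<open>L\<close>, and
  \<open>\<alpha> X Y Z\<close> for \<open>\<langle>(\<nabla>\<^sub>X J) Y, Z\<rangle>\<close>.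
\<close>

locale metric_connection_form =
  fixes L :: "'v set" and K :: "'v \<Rightarrow> 'v" and \<Gamma> :: "'v \<Rightarrow> 'v \<Rightarrow> 'v \<Rightarrow> real"
  assumes K_closed: "X \<in> L \<Longrightarrow> K X \<in> L"
    and skew: "\<lbrakk>X \<in> L; Y \<in> L; Z \<in> L\<rbrakk> \<Longrightarrow> \<Gamma> X Y Z = - \<Gamma> X Z Y"
    and K_K_first: "\<lbrakk>X \<in> L; Y \<in> L; Z \<in> L\<rbrakk> \<Longrightarrow> \<Gamma> (K (K X)) Y Z = - \<Gamma> X Y Z"
    and K_K_last: "\<lbrakk>X \<in> L; Y \<in> L; Z \<in> L\<rbrakk> \<Longrightarrow> \<Gamma> X Y (K (K Z)) = - \<Gamma> X Y Z"
begin

text \<open>The term with \<open>J\<close> outside the connection has \<open>K\<close> in its last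
  slot because \<open>J\<close> is symmetric for g. In this form only \<open>\<Gamma>\<close> and
  \<open>K\<close> enter.\<close>

definition \<alpha> :: "'v \<Rightarrow> 'v \<Rightarrow> 'v \<Rightarrow> real" where
  "\<alpha> X Y Z = \<Gamma> X (K Y) Z - \<Gamma> X Y (K Z)"

definition \<theta> :: "'v \<Rightarrow> 'v \<Rightarrow> 'v \<Rightarrow> real" where
  "\<theta> X Y Z = (\<Gamma> (K X) Y Z + \<Gamma> X Y (K Z)) + (\<Gamma> (K Y) Z X + \<Gamma> Y Z (K X))
    + (\<Gamma> (K Z) X Y + \<Gamma> Z X (K Y))"

text \<open>Used to rotate skewness in the last two slots, and purity in the first two, to the
  remaining pairs.\<close>

lemma \<theta>_cyclic: "\<theta> Y Z X = \<theta> X Y Z"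
  by (simp add: \<theta>_def)

lemma \<alpha>_K_middle:
  assumes "X \<in> L" "Y \<in> L" "Z \<in> L"
  shows "\<alpha> X (K Y) Z = - \<alpha> X Y (K Z)"
  \<comment> \<open>Skewness carries the double \<open>K\<close> from the middle slot to the last
    one, where it becomes a sign, and back.\<close>
  using K_K_last[OF assms] K_K_last[of X Z Y] skew[of X "K (K Y)" Z] skew[OF assms]
  by (simp add: \<alpha>_def K_closed assms)

lemma \<alpha>_K_K_first: "\<lbrakk>X \<in> L; Y \<in> L; Z \<in> L\<rbrakk> \<Longrightarrow> \<alpha> (K (K X)) Y Z = - \<alpha> X Y Z"
  by (simp add: \<alpha>_def K_closed K_K_first)

text \<open>The terms with \<open>K\<close> in the first slot cancel by skewness of
  \<open>\<Gamma>\<close>. The others pair up as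
  \<open>\<Gamma> X Y (K Z) + \<Gamma> X Z (K Y) = - \<alpha> X Y Z\<close> and its cyclic
  shifts.\<close>

lemma \<theta>_skew_defect:
  assumes "X \<in> L" "Y \<in> L" "Z \<in> L"
  shows "\<theta> X Y Z + \<theta> X Z Y = - (\<alpha> X Y Z + \<alpha> Y Z X + \<alpha> Z X Y)"
  using assms skew[of "K X" Y Z] skew[of "K Y" Z X] skew[of "K Z" X Y]
    skew[of X "K Y" Z] skew[of Y "K Z" X] skew[of Z "K X" Y]
  by (simp add: \<theta>_def \<alpha>_def K_closed)

text \<open>The terms differentiating along \<open>Y\<close> or \<open>K Y\<close> amount to
  \<open>\<Gamma> (K Y) Z (K X) - \<Gamma> Y Z X\<close> in both values of \<open>\<theta>\<close>
  and cancel. Those along \<open>Z\<close> form the first bracket, those along \<open>X\<close> the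
  second.\<close>

lemma \<theta>_pure_defect:
  assumes "X \<in> L" "Y \<in> L" "Z \<in> L"
  shows "\<theta> (K X) Y Z - \<theta> X (K Y) Z =
    (\<alpha> (K Z) X Y + \<alpha> Z X (K Y)) - (\<alpha> (K X) Y Z + \<alpha> X Y (K Z))"
  using assms
  by (simp add: \<theta>_def \<alpha>_def K_closed K_K_first K_K_last)

lemma \<theta>_skew_pure_if_parallel:
  assumes parallel: "\<And>X Y Z. \<lbrakk>X \<in> L; Y \<in> L; Z \<in> L\<rbrakk> \<Longrightarrow> \<alpha> X Y Z = 0"
  shows "skew_symmetric3_on L \<theta>" "pure3_on L K \<theta>"
proof -
  have skew2: "\<theta> X Z Y = - \<theta> X Y Z" if "X \<in> L" "Y \<in> L" "Z \<in> L" for X Y Z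
    using \<theta>_skew_defect[OF that] parallel that by simp
  show "skew_symmetric3_on L \<theta>"
    unfolding skew_symmetric3_on_def
    using skew2 \<theta>_cyclic by metis
  have pure: "\<theta> (K X) Y Z = \<theta> X (K Y) Z" if "X \<in> L" "Y \<in> L" "Z \<in> L" for X Y Z
    using \<theta>_pure_defect[OF that] parallel that by (simp add: K_closed)
  show "pure3_on L K \<theta>"
    unfolding pure3_on_def
    using pure \<theta>_cyclic by metis
qed

lemma parallel_if_\<theta>_skew_pure:
  assumes skew_\<theta>: "\<And>X Y Z. \<lbrakk>X \<in> L; Y \<in> L; Z \<in> L\<rbrakk> \<Longrightarrow> \<theta> X Y Z = - \<theta> X Z Y"
    and pure_\<theta>: "\<And>X Y Z. \<lbrakk>X \<in> L; Y \<in> L; Z \<in> L\<rbrakk> \<Longrightarrow> \<theta> (K X) Y Z = \<theta> X (K Y) Z"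
    and XYZ: "X \<in> L" "Y \<in> L" "Z \<in> L"
  shows "\<alpha> X Y Z = 0"
proof -
  have cyc: "\<alpha> X Y Z + \<alpha> Y Z X + \<alpha> Z X Y = 0" if "X \<in> L" "Y \<in> L" "Z \<in> L" for X Y Z
    using \<theta>_skew_defect[OF that] skew_\<theta>[OF that] by simp
  have first: "\<alpha> (K X) Y Z = \<alpha> Z X (K Y) - \<alpha> Y Z (K X)"
    if "X \<in> L" "Y \<in> L" "Z \<in> L" for X Y Z
    using cyc[of "K X" Y Z] \<alpha>_K_middle[of Z X Y] that by (simp add: K_closed)
  \<comment> \<open>Substituting \<open>first\<close> for both values with \<open>K\<close> in front
    cancels \<open>\<alpha> Z X (K Y)\<close> and leaves twice the difference of the two
    sides.\<close>
  have shift: "\<alpha> X Y (K Z) = \<alpha> Y Z (K X)" if "X \<in> L" "Y \<in> L" "Z \<in> L" for X Y Z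
    using \<theta>_pure_defect[OF that] pure_\<theta>[OF that] first[OF that] first[of Z X Y] that by simp
  have "\<alpha> (K X) Y Z = 0" if "X \<in> L" "Y \<in> L" "Z \<in> L" for X Y Z
    using first[OF that] shift[OF that] shift[of Z X Y] that by simp
  \<comment> \<open>Every value of \<open>\<alpha>\<close> is covered, because a double
    \<open>K\<close> in the first slot only changes the sign.\<close>
  then show ?thesis
    using \<alpha>_K_K_first[OF XYZ] XYZ K_closed by simp
qed

end

section \<open>Left invariant anti-Hermitian structures\<close>

locale left_invariant_anti_hermitian_group = smooth_group A gmult gone ginv
  for A :: "('a::{t2_space,second_countable_topology}, 'e::euclidean_space) chart set"
    and gmult gone ginv +
  fixes g :: "'a \<Rightarrow> 'e \<Rightarrow> 'e \<Rightarrow> real" and J :: "'a \<Rightarrow> 'e \<Rightarrow> 'e"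
    and nabla :: "('a \<Rightarrow> 'e) \<Rightarrow> ('a \<Rightarrow> 'e) \<Rightarrow> 'a \<Rightarrow> 'e"
  assumes anti_hermitian: "left_invariant_almost_anti_hermitian A gmult g J"
    and connection: "levi_civita_connection A g nabla"
begin

abbreviation \<gg> :: "('a \<Rightarrow> 'e) set" where "\<gg> \<equiv> lie_algebra A gmult"

lemma almost_anti_hermitian: "almost_anti_hermitian A g J"
  using anti_hermitian unfolding left_invariant_almost_anti_hermitian_def by blast

lemma g_bilinear: "bilinear (g p)"
  and g_sym: "g p v w = g p w v"
  and g_nondegenerate: "(\<And>w. g p v w = 0) \<Longrightarrow> v = 0"
  and g_smooth: "X \<in> vector_fields A \<Longrightarrow> Y \<in> vector_fields A \<Longrightarrow> smooth_fun A UNIV (\<lambda>p. g p (X p) (Y p))"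
  using almost_anti_hermitian
  unfolding almost_anti_hermitian_def pseudo_riemannian_metric_def by blast+

lemma J_linear: "linear (J p)"
  and J_J: "J p (J p v) = - v"
  and J_vector_field: "X \<in> vector_fields A \<Longrightarrow> endo_apply J X \<in> vector_fields A"
  and g_J_J: "g p (J p v) (J p w) = - g p v w"
  using almost_anti_hermitian
  unfolding almost_anti_hermitian_def almost_complex_structure_def by blast+

text \<open>From the anti-Hermitian identity applied to \<open>v\<close> and \<open>J p w\<close>.
  It makes \<open>J\<close> self-adjoint, where a Hermitian structure would be skew-adjoint.\<close>

lemma g_J: "g p (J p v) w = g p v (J p w)"
  using g_J_J[of p v "J p w"] bilinear_rneg[OF g_bilinear] by (simp add: J_J)

lemma J_left_invariant:
  "J (gmult a p) (tangent_map A A (gmult a) p v) = tangent_map A A (gmult a) p (J p v)"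
  using anti_hermitian unfolding left_invariant_almost_anti_hermitian_def left_invariant_endo_def by blast

lemma g_left_invariant:
  "g (gmult a p) (tangent_map A A (gmult a) p v) (tangent_map A A (gmult a) p w) = g p v w"
  using anti_hermitian unfolding left_invariant_almost_anti_hermitian_def left_invariant_metric_def by blast

lemma J_lie_algebra: "X \<in> \<gg> \<Longrightarrow> endo_apply J X \<in> \<gg>"
  by (simp add: lie_algebra_def J_vector_field) (simp add: endo_apply_def J_left_invariant[symmetric])

lemma g_constant:
  assumes "X \<in> \<gg>" "Y \<in> \<gg>"
  shows "g p (X p) (Y p) = lie_inner gone g X Y"
  using g_left_invariant[of p gone "X gone" "Y gone"]
    lie_algebra_left_invariant[OF assms(1), of p gone] lie_algebra_left_invariant[OF assms(2), of p gone]
  by (simp add: lie_inner_def)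

lemma affine_nabla: "affine_connection A nabla"
  and torsion: "\<lbrakk>X \<in> vector_fields A; Y \<in> vector_fields A\<rbrakk> \<Longrightarrow>
    is_lie_bracket A X Y (\<lambda>p. nabla X Y p - nabla Y X p)"
  and metric: "\<lbrakk>X \<in> vector_fields A; Y \<in> vector_fields A; Z \<in> vector_fields A\<rbrakk> \<Longrightarrow>
    vf_apply A X (\<lambda>q. g q (Y q) (Z q)) p = g p (nabla X Y p) (Z p) + g p (Y p) (nabla X Z p)"
  using connection unfolding levi_civita_connection_def by blast+

lemma nabla_add_left: "\<lbrakk>X \<in> vector_fields A; X' \<in> vector_fields A; Y \<in> vector_fields A\<rbrakk> \<Longrightarrow>
    nabla (\<lambda>p. X p + X' p) Y = (\<lambda>p. nabla X Y p + nabla X' Y p)"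
  and nabla_add_right: "\<lbrakk>X \<in> vector_fields A; Y \<in> vector_fields A; Y' \<in> vector_fields A\<rbrakk> \<Longrightarrow>
    nabla X (\<lambda>p. Y p + Y' p) = (\<lambda>p. nabla X Y p + nabla X Y' p)"
  and nabla_scaleR_left: "\<lbrakk>X \<in> vector_fields A; Y \<in> vector_fields A; smooth_fun A UNIV f\<rbrakk> \<Longrightarrow>
    nabla (\<lambda>p. f p *\<^sub>R X p) Y = (\<lambda>p. f p *\<^sub>R nabla X Y p)"
  and nabla_scaleR_right: "\<lbrakk>X \<in> vector_fields A; Y \<in> vector_fields A; smooth_fun A UNIV f\<rbrakk> \<Longrightarrow>
    nabla X (\<lambda>p. f p *\<^sub>R Y p) = (\<lambda>p. vf_apply A X f p *\<^sub>R Y p + f p *\<^sub>R nabla X Y p)"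
  using affine_nabla unfolding affine_connection_def by blast+

section \<open>The Levi-Civita connection on left invariant fields\<close>

lemma nabla_skew:
  assumes "X \<in> \<gg>" "Y \<in> \<gg>" "Z \<in> \<gg>"
  shows "g p (nabla X Y p) (Z p) = - g p (nabla X Z p) (Y p)"
proof -
  have "vf_apply A X (\<lambda>q. g q (Y q) (Z q)) p = 0"
    by (simp add: g_constant assms vf_apply_const)
  then show ?thesis
    using metric[of X Y Z p] assms lie_algebra_vector_field g_sym[of p "Y p"] by simp
qed

text \<open>
  Koszul's formula: the derivatives of inner products vanish, and the remaining terms are inner
  products with brackets, which are again left invariant.
\<close>

lemma nabla_constant:
  assumes "X \<in> \<gg>" "Y \<in> \<gg>" "Z \<in> \<gg>"
  shows "g p (nabla X Y p) (Z p) = lie_inner gone g (nabla X Y) Z"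
proof -
  \<comment> \<open>By vanishing torsion this is the inner product at \<open>q\<close> of the
    bracket of \<open>X\<close> and \<open>Y\<close> with \<open>Z\<close>.\<close>
  define T where "T q X Y Z = g q (nabla X Y q) (Z q) - g q (nabla Y X q) (Z q)" for q X Y Z
  have T: "T p X Y Z = T gone X Y Z" if "X \<in> \<gg>" "Y \<in> \<gg>" "Z \<in> \<gg>" for X Y Z
  proof -
    define W where "W = (\<lambda>p. nabla X Y p - nabla Y X p)"
    have W: "W \<in> \<gg>"
      unfolding W_def
      by (rule lie_bracket_left_invariant[OF that(1,2)
            torsion[OF lie_algebra_vector_field[OF that(1)] lie_algebra_vector_field[OF that(2)]]])
    have "T q X Y Z = g q (W q) (Z q)" for q
      by (simp add: T_def W_def bilinear_lsub[OF g_bilinear])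
    then show ?thesis using g_constant[OF W that(3), of p] by (simp add: lie_inner_def)
  qed
  \<comment> \<open>Skewness cancels the terms differentiating along \<open>Y\<close> and those
    along \<open>Z\<close>, and makes the two along \<open>X\<close> equal.\<close>
  have "2 * g q (nabla X Y q) (Z q) = T q X Y Z - T q Y Z X + T q Z X Y" for q
    unfolding T_def
    using nabla_skew[OF assms, of q] nabla_skew[OF assms(2,3,1), of q] nabla_skew[OF assms(3,1,2), of q]
    by linarith
  from this[of p] this[of gone] show ?thesis
    unfolding lie_inner_def
    using T[OF assms] T[OF assms(2,3,1)] T[OF assms(3,1,2)] by linarith
qed

sublocale form: metric_connection_form \<gg> "endo_apply J" "\<lambda>X Y Z. lie_inner gone g (nabla X Y) Z"
proof
  fix X Y Z assume X: "X \<in> \<gg>" and Y: "Y \<in> \<gg>" and Z: "Z \<in> \<gg>"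
  show "lie_inner gone g (nabla X Y) Z = - lie_inner gone g (nabla X Z) Y"
    unfolding lie_inner_def by (rule nabla_skew[OF X Y Z])
  \<comment> \<open>The sign is written as a constant function factor so that linearity of
    \<open>nabla\<close> over functions applies.\<close>
  have JJ: "endo_apply J (endo_apply J W) = (\<lambda>p. (-1) *\<^sub>R W p)" for W
    by (simp add: endo_apply_def J_J)
  have "nabla (endo_apply J (endo_apply J X)) Y = (\<lambda>p. (-1) *\<^sub>R nabla X Y p)"
    unfolding JJ by (rule nabla_scaleR_left[OF lie_algebra_vector_field[OF X]
          lie_algebra_vector_field[OF Y] smooth_fun_const])
  then show "lie_inner gone g (nabla (endo_apply J (endo_apply J X)) Y) Z = - lie_inner gone g (nabla X Y) Z"
    by (simp add: lie_inner_def bilinear_lneg[OF g_bilinear])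
  show "lie_inner gone g (nabla X Y) (endo_apply J (endo_apply J Z)) = - lie_inner gone g (nabla X Y) Z"
    by (simp add: JJ lie_inner_def bilinear_rneg[OF g_bilinear])
qed (rule J_lie_algebra)

text \<open>Only pointwise bilinearity of g and symmetry of \<open>J\<close> enter, so equality
  holds for all arguments and permits rewriting of \<open>theta\<close> as a function.\<close>

lemma theta_eq: "theta gone g nabla J = form.\<theta>"
proof (intro ext)
  fix X Y Z
  have "lie_inner gone g (D_field nabla J X Y) Z =
      lie_inner gone g (nabla (endo_apply J X) Y) Z + lie_inner gone g (nabla X Y) (endo_apply J Z)" for X Y Z
    by (simp add: lie_inner_def D_field_def bilinear_ladd[OF g_bilinear] g_J endo_apply_def)
  then show "theta gone g nabla J X Y Z = form.\<theta> X Y Z"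
    unfolding theta_def form.\<theta>_def by simp
qed

text \<open>The right side does not depend on \<open>p\<close>: vanishing of the algebraic tensor is
  felt at every point of the group.\<close>

lemma cov_deriv_endo_lie_algebra:
  assumes "X \<in> \<gg>" "Y \<in> \<gg>" "Z \<in> \<gg>"
  shows "g p (cov_deriv_endo nabla J X Y p) (Z p) = form.\<alpha> X Y Z"
proof -
  have "g p (cov_deriv_endo nabla J X Y p) (Z p)
      = g p (nabla X (endo_apply J Y) p) (Z p) - g p (nabla X Y p) (endo_apply J Z p)"
    by (simp add: cov_deriv_endo_def bilinear_lsub[OF g_bilinear] endo_apply_def g_J)
  then show ?thesis
    using nabla_constant[OF assms(1) J_lie_algebra[OF assms(2)] assms(3)]
      nabla_constant[OF assms(1,2) J_lie_algebra[OF assms(3)]]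
    by (simp add: form.\<alpha>_def)
qed

text \<open>\<open>T\<close> represents g at the identity with respect to the Euclidean inner
  product. Its kernel is the radical of g, so it is bijective, and its inverse sends the standard
  basis to the dual one.\<close>

lemma dual_basis: "\<exists>\<psi>. \<forall>i\<in>Basis. \<forall>v. g gone v (\<psi> i) = v \<bullet> i"
proof -
  define T where "T w = (\<Sum>j\<in>Basis. g gone j w *\<^sub>R j)" for w
  have T_inner: "T w \<bullet> j = g gone j w" if "j \<in> Basis" for w j
    using that by (simp add: T_def inner_sum_left inner_Basis if_distrib sum.delta cong: if_cong)
  have g_T: "g gone v w = v \<bullet> T w" for v w
  proof -
    have "g gone v w = g gone (\<Sum>j\<in>Basis. (v \<bullet> j) *\<^sub>R j) w"
      by (simp add: euclidean_representation)
    also have "\<dots> = (\<Sum>j\<in>Basis. (v \<bullet> j) * g gone j w)"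
      using g_bilinear[of gone, unfolded bilinear_def]
      by (simp add: linear_sum[of "\<lambda>v. g gone v w"] linear_scale[of "\<lambda>v. g gone v w"])
    also have "\<dots> = v \<bullet> T w"
      by (simp add: T_def inner_sum_right mult.commute)
    finally show ?thesis .
  qed
  have lin: "linear T"
    unfolding T_def
    by (rule linearI) (simp_all add: bilinear_radd[OF g_bilinear] bilinear_rmul[OF g_bilinear]
        scaleR_add_left sum.distrib scaleR_sum_right)
  have "w = 0" if "T w = 0" for w
    by (rule g_nondegenerate[of gone]) (subst g_sym, simp add: g_T that)
  then have "inj T" using linear_injective_0[OF lin] by blast
  then have "surj T" by (rule linear_injective_imp_surjective[OF lin _ refl])
  then have "T (inv T i) = i" for i by (rule surj_f_inv_f)
  then show ?thesis using g_T by (intro exI[of _ "inv T"]) simp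
qed

text \<open>
  The coefficients of \<open>X\<close> in a left invariant frame are its inner products with a dual left invariant
  frame; hence they are smooth because the metric is.
\<close>

lemma vector_field_induct [consumes 1, case_names left_invariant add scaleR]:
  assumes "X \<in> vector_fields A"
    and left_invariant: "\<And>X. X \<in> \<gg> \<Longrightarrow> P X"
    and add: "\<And>X Y. \<lbrakk>X \<in> vector_fields A; Y \<in> vector_fields A; P X; P Y\<rbrakk> \<Longrightarrow> P (\<lambda>p. X p + Y p)"
    and scaleR: "\<And>f X. \<lbrakk>smooth_fun A UNIV f; X \<in> vector_fields A; P X\<rbrakk> \<Longrightarrow> P (\<lambda>p. f p *\<^sub>R X p)"
  shows "P X"
proof -
  obtain \<psi> where \<psi>: "\<And>i v. i \<in> Basis \<Longrightarrow> g gone v (\<psi> i) = v \<bullet> i"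
    using dual_basis by blast
  define f where "f i = (\<lambda>p. g p (X p) (left_inv_field (\<psi> i) p))" for i
  have f: "smooth_fun A UNIV (f i)" for i
    unfolding f_def by (rule g_smooth[OF assms(1) left_inv_field_vector_field])
  \<comment> \<open>Membership in \<open>vector_fields\<close> is carried along because the
    \<open>add\<close> case asks for it.\<close>
  have sums: "(\<lambda>p. \<Sum>i\<in>I. f i p *\<^sub>R left_inv_field i p) \<in> vector_fields A \<and>
      P (\<lambda>p. \<Sum>i\<in>I. f i p *\<^sub>R left_inv_field i p)" if "finite I" for I
    using that
  proof (induction I rule: finite_induct)
    case empty
    \<comment> \<open>The empty sum is itself a left invariant field, so it falls under the first
      case.\<close>
    have "left_inv_field 0 = (\<lambda>p. 0)"
      using linear_0[OF linear_left_inv_field] by auto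
    then show ?case
      using left_inv_field_vector_field[of 0] left_invariant[OF left_inv_field_lie_algebra[of 0]] by simp
  next
    case (insert i I)
    note E = left_inv_field_vector_field[of i]
    show ?case
      using insert vector_fields_scaleR[OF E f, of i]
        scaleR[OF f E left_invariant[OF left_inv_field_lie_algebra], of i]
      by (auto intro!: add vector_fields_add)
  qed
  have "X p = (\<Sum>i\<in>Basis. f i p *\<^sub>R left_inv_field i p)" for p
  proof -
    obtain v where v: "left_inv_field v p = X p" using left_inv_field_surj by blast
    \<comment> \<open>Near \<open>p\<close> the field \<open>X\<close> need not be invariant, but at
      \<open>p\<close> it agrees with an invariant field, whose inner products can be evaluated at
      the identity.\<close>
    have "f i p = v \<bullet> i" if "i \<in> Basis" for i
      using g_constant[OF left_inv_field_lie_algebra left_inv_field_lie_algebra, of p v "\<psi> i"] \<psi>[OF that]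
      by (simp add: f_def v lie_inner_def left_inv_field_gone)
    moreover have "left_inv_field v p = left_inv_field (\<Sum>i\<in>Basis. (v \<bullet> i) *\<^sub>R i) p"
      by (simp add: euclidean_representation)
    ultimately show ?thesis
      using v by (simp add: linear_sum[OF linear_left_inv_field] linear_scale[OF linear_left_inv_field])
  qed
  then show ?thesis using sums[OF finite_Basis] by presburger
qed

section \<open>Extension from the Lie algebra to all vector fields\<close>

lemma endo_apply_add: "endo_apply J (\<lambda>p. X p + Y p) = (\<lambda>p. endo_apply J X p + endo_apply J Y p)"
  by (simp add: endo_apply_def linear_add[OF J_linear])

lemma endo_apply_scaleR: "endo_apply J (\<lambda>p. f p *\<^sub>R X p) = (\<lambda>p. f p *\<^sub>R endo_apply J X p)"
  by (simp add: endo_apply_def linear_scale[OF J_linear])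

lemma anti_kaehler_iff:
  "anti_kaehler A g J nabla \<longleftrightarrow> (\<forall>X\<in>\<gg>. \<forall>Y\<in>\<gg>. \<forall>Z\<in>\<gg>. form.\<alpha> X Y Z = 0)"
proof
  assume "anti_kaehler A g J nabla"
  then have "cov_deriv_endo nabla J X Y = (\<lambda>p. 0)" if "X \<in> \<gg>" "Y \<in> \<gg>" for X Y
    using that lie_algebra_vector_field unfolding anti_kaehler_def by blast
  then have "form.\<alpha> X Y Z = 0" if "X \<in> \<gg>" "Y \<in> \<gg>" "Z \<in> \<gg>" for X Y Z
    using cov_deriv_endo_lie_algebra[OF that, of gone] that by (simp add: bilinear_lzero[OF g_bilinear])
  then show "\<forall>X\<in>\<gg>. \<forall>Y\<in>\<gg>. \<forall>Z\<in>\<gg>. form.\<alpha> X Y Z = 0" by blast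
next
  assume \<alpha>: "\<forall>X\<in>\<gg>. \<forall>Y\<in>\<gg>. \<forall>Z\<in>\<gg>. form.\<alpha> X Y Z = 0"
  have base: "cov_deriv_endo nabla J X Y = (\<lambda>p. 0)" if "X \<in> \<gg>" "Y \<in> \<gg>" for X Y
  proof
    fix p
    show "cov_deriv_endo nabla J X Y p = 0"
    proof (rule g_nondegenerate)
      fix w
      obtain v where "left_inv_field v p = w" using left_inv_field_surj by blast
      then show "g p (cov_deriv_endo nabla J X Y p) w = 0"
        using cov_deriv_endo_lie_algebra[OF that left_inv_field_lie_algebra, of p v] \<alpha> that
          left_inv_field_lie_algebra by simp
    qed
  qed
  \<comment> \<open>The arguments are extended one at a time: \<open>X\<close> becomes arbitrary
    while \<open>Y\<close> stays invariant, so that this can serve as the base case for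
    \<open>Y\<close>.\<close>
  have left: "cov_deriv_endo nabla J X Y = (\<lambda>p. 0)" if "X \<in> vector_fields A" and Y: "Y \<in> \<gg>" for X Y
    using that(1)
  proof (induction rule: vector_field_induct)
    case (left_invariant X)
    then show ?case using base Y by blast
  next
    case (add X X')
    note Y' = lie_algebra_vector_field[OF Y]
    from add show ?case
      by (simp add: cov_deriv_endo_def nabla_add_left Y' J_vector_field endo_apply_add
          fun_eq_iff algebra_simps)
  next
    case (scaleR f X)
    note Y' = lie_algebra_vector_field[OF Y]
    from scaleR show ?case
      by (simp add: cov_deriv_endo_def nabla_scaleR_left Y' J_vector_field endo_apply_scaleR fun_eq_iff)
  qed
  have "cov_deriv_endo nabla J X Y = (\<lambda>p. 0)" if X: "X \<in> vector_fields A" and "Y \<in> vector_fields A" for X Y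
    using that(2)
  proof (induction rule: vector_field_induct)
    case (left_invariant Y)
    then show ?case using left X by blast
  next
    case (add Y Y')
    then show ?case
      by (simp add: cov_deriv_endo_def nabla_add_right X J_vector_field endo_apply_add
          fun_eq_iff algebra_simps)
  next
    \<comment> \<open>The Leibniz rule produces the derivative of \<open>f\<close> times
      \<open>J Y\<close> in both terms of the covariant derivative; they cancel because
      \<open>J\<close> is linear at each point.\<close>
    case (scaleR f Y)
    then show ?case
      by (simp add: cov_deriv_endo_def nabla_scaleR_right X J_vector_field endo_apply_scaleR
          endo_apply_add fun_eq_iff)
  qed
  then show "anti_kaehler A g J nabla"
    using almost_anti_hermitian unfolding anti_kaehler_def by blast
qed

section \<open>The two forms of the criterion\<close>

lemma anti_kaehler_theta:
  "anti_kaehler A g J nabla \<Longrightarrow> skew_symmetric3_on \<gg> (theta gone g nabla J)"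
  "anti_kaehler A g J nabla \<Longrightarrow> pure3_on \<gg> (endo_apply J) (theta gone g nabla J)"
  unfolding anti_kaehler_iff theta_eq by (intro form.\<theta>_skew_pure_if_parallel; blast)+

lemma anti_kaehler_if_theta:
  assumes "\<And>X Y Z. \<lbrakk>X \<in> \<gg>; Y \<in> \<gg>; Z \<in> \<gg>\<rbrakk> \<Longrightarrow>
      theta gone g nabla J X Y Z = - theta gone g nabla J X Z Y"
    and "\<And>X Y Z. \<lbrakk>X \<in> \<gg>; Y \<in> \<gg>; Z \<in> \<gg>\<rbrakk> \<Longrightarrow>
      theta gone g nabla J (endo_apply J X) Y Z = theta gone g nabla J X (endo_apply J Y) Z"
  shows "anti_kaehler A g J nabla"
  unfolding anti_kaehler_iff
  using form.parallel_if_\<theta>_skew_pure[OF assms[unfolded theta_eq]] by blast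

lemma anti_kaehler_iff_theta:
  "anti_kaehler A g J nabla \<longleftrightarrow> (\<forall>X\<in>\<gg>. \<forall>Y\<in>\<gg>. \<forall>Z\<in>\<gg>.
      theta gone g nabla J X Y Z = - theta gone g nabla J X Z Y \<and>
      theta gone g nabla J (endo_apply J X) Y Z = theta gone g nabla J X (endo_apply J Y) Z)"
  (is "?ak \<longleftrightarrow> ?eqs")
proof
  assume ?ak
  show ?eqs
  proof (intro ballI conjI)
    fix X Y Z assume "X \<in> \<gg>" "Y \<in> \<gg>" "Z \<in> \<gg>"
    with anti_kaehler_theta(1)[OF \<open>?ak\<close>]
    have "theta gone g nabla J X Z Y = - theta gone g nabla J X Y Z"
      unfolding skew_symmetric3_on_def by blast
    then show "theta gone g nabla J X Y Z = - theta gone g nabla J X Z Y" by linarith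
    show "theta gone g nabla J (endo_apply J X) Y Z = theta gone g nabla J X (endo_apply J Y) Z"
      using anti_kaehler_theta(2)[OF \<open>?ak\<close>] \<open>X \<in> \<gg>\<close> \<open>Y \<in> \<gg>\<close> \<open>Z \<in> \<gg>\<close>
      unfolding pure3_on_def by blast
  qed
qed (blast intro: anti_kaehler_if_theta)

lemma anti_kaehler_iff_skew_pure:
  "anti_kaehler A g J nabla \<longleftrightarrow>
    skew_symmetric3_on \<gg> (theta gone g nabla J) \<and> pure3_on \<gg> (endo_apply J) (theta gone g nabla J)"
proof
  assume sp: "skew_symmetric3_on \<gg> (theta gone g nabla J) \<and>
    pure3_on \<gg> (endo_apply J) (theta gone g nabla J)"
  show "anti_kaehler A g J nabla"
  proof (rule anti_kaehler_if_theta)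
    fix X Y Z assume "X \<in> \<gg>" "Y \<in> \<gg>" "Z \<in> \<gg>"
    with sp show "theta gone g nabla J X Y Z = - theta gone g nabla J X Z Y"
      and "theta gone g nabla J (endo_apply J X) Y Z = theta gone g nabla J X (endo_apply J Y) Z"
      unfolding skew_symmetric3_on_def pure3_on_def by blast+
  qed
qed (blast intro: anti_kaehler_theta)

end

theorem theorem5p1:
  fixes A :: "('a::{t2_space,second_countable_topology}, 'e::euclidean_space) chart set"
    and gmult :: "'a \<Rightarrow> 'a \<Rightarrow> 'a" and gone :: 'a and ginv :: "'a \<Rightarrow> 'a"
    and g :: "'a \<Rightarrow> 'e \<Rightarrow> 'e \<Rightarrow> real" and J :: "'a \<Rightarrow> 'e \<Rightarrow> 'e"
    and nabla :: "('a \<Rightarrow> 'e) \<Rightarrow> ('a \<Rightarrow> 'e) \<Rightarrow> 'a \<Rightarrow> 'e"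
  assumes "lie_group A gmult gone ginv"
    and "left_invariant_almost_anti_hermitian A gmult g J"
    and "levi_civita_connection A g nabla"
  shows "(anti_kaehler A g J nabla \<longleftrightarrow>
            skew_symmetric3_on (lie_algebra A gmult) (theta gone g nabla J) \<and>
            pure3_on (lie_algebra A gmult) (endo_apply J) (theta gone g nabla J)) \<and>
         (anti_kaehler A g J nabla \<longleftrightarrow>
            (\<forall>X\<in>lie_algebra A gmult. \<forall>Y\<in>lie_algebra A gmult. \<forall>Z\<in>lie_algebra A gmult.
               theta gone g nabla J X Y Z = - theta gone g nabla J X Z Y \<and>
               theta gone g nabla J (endo_apply J X) Y Z = theta gone g nabla J X (endo_apply J Y) Z))"
proof -
  interpret left_invariant_anti_hermitian_group A gmult gone ginv g J nabla
    using assms by unfold_locales (simp_all add: lie_group_def)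
  show ?thesis
    using anti_kaehler_iff_skew_pure anti_kaehler_iff_theta by (rule conjI)
qed

end
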